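(* For a given $l$, $1\leq l\leq h^+(\alpha)$, and integers $c_1, \dots, c_d$, set \[ C = \sum_{1\leq i\leq d} c_i B_{li}, \quad \xi = \sum_{1\leq i\leq d} c_i \overline{\beta}_{li}. \] Assume that $\xi \in \mathcal{D}$ and that $\gcd(\det C_{1d}, \det C_{2d}, \dots, \det C_{dd}) = 1$, where $C_{ij}$ is the $(d-1)\times (d-1)$ minor of $C$ obtained by removing the $i$th row and $j$th column, so there exist integers $u_j$, $1\leq j \leq d$, with $\sum_{1\leq j \leq d} (-1)^{j+d} u_j \det C_{jd} = 1$. Then \[ \gamma^{-1} = \begin{pmatrix} c_{11} & \cdots & c_{1(d-1)} & u_1 \\ \vdots & \ddots & \vdots & \vdots \\ c_{d1} & \cdots & c_{d(d-1)} & u_d \end{pmatrix} \in \Gamma, \] where $c_{ij}$ are the entries of $C$, satisfies \[ \gamma \mathfrak{B}_l \begin{pmatrix} \xi^{(1)} & \cdots & 0 \\ \vdots & \ddots & \vdots \\ 0 & \cdots & \xi^{(d)} \end{pmatrix} = \begin{pmatrix} 1 & \cdots & 0 & -\mu^{d-1} \\ \vdots & \ddots & \vdots & \vdots \\ 0 & \cdots & 1 & -\mu \\ 0 & \cdots & 0 & m \end{pmatrix}\mathfrak{B}_1 \quad\text{and}\quad \begin{pmatrix} 1 & \cdots & 0 & -\mu^{d-1} \\ \vdots & \ddots & \vdots & \vdots \\ 0 & \cdots & 1 & -\mu \\ 0 & \cdots & 0 & m \end{pmatrix} = \gamma C, \] where $m$ is a positive integer and $\mu \pmod m$ satisfies $F(\mu)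 \equiv 0 \pmod m$. Moreover, given a positive integer $m$ and $\mu\pmod m$ with $F(\mu)\equiv 0\pmod m$ such that the ideal of $\mathbb{Z}[\alpha]$ with basis $\begin{pmatrix} 1 & \cdots & 0 & -\mu^{d-1} \\ \vdots & \ddots & \vdots & \vdots \\ 0 & \cdots & 1 & -\mu \\ 0 & \cdots & 0 & m \end{pmatrix}(\alpha^{d-1},\dots,\alpha,1)^T$ is invertible, there exist a unique $l$ and unique integers $c_1, \dots, c_d$ (satisfying the assumptions above) for which the two displayed equations hold with this $m$ and $\mu$, with different choices of the integers $u_j$ corresponding to different representatives of the residue classes $\mu^j \pmod m$.
   Context: Let $F(X) = X^d + a_1 X^{d-1} + \cdots + a_d \in \mathbb{Z}[X]$ be monic and irreducible, and let $\alpha$ be a root of $F$, identified with the vector in $\mathbb{C}^d$ of its $d$ complex embeddings. Let $r_1$, $r_2$ be the numbers of real embeddings and of conjugate pairs of complex embeddings; $C_{r_1,r_2}\subset\mathbb{C}^d$ is the set of vectors whose first $r_1$ coordinates are real and whose remaining $2r_2$ coordinates come in consecutive complex-conjugate pairs, and $C^+_{r_1,r_2}$ the subset with positive real coordinates. $h^+(\alpha)$ is the narrow class number of $\mathbb{Z}[\alpha]$; $I_l$, $1\le l\le h^+(\alpha)$, are fixed integral ideal representatives of the narrow classes with $I_1=\mathbb{Z}[\alpha]$, with fixed $\mathbb{Z}$-bases $\{\beta_{l1},\dots,\beta_{ld}\}$ (for $l=1$: $\{\alpha^{d-1},\dots,\alpha,1\}$). $\mathfrak{B}_l$ is the $d\times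 d$ matrix with $(i,j)$ entry $\beta_{li}^{(j)}$ (the $j$th embedding of $\beta_{li}$), and $\mathrm{sign}\det\mathfrak{B}_l=\mathrm{sign}\det\mathfrak{B}_1$. $\Gamma=\mathrm{SL}(d,\mathbb{Z})$. For each $l$, $\{\overline{\beta}_{l1}, \dots, \overline{\beta}_{ld}\}$ is a fixed basis of $I_l^{-1}$, integers $b_{ijkl}$ are defined by $\overline{\beta}_{li}\beta_{lj} = \sum_{1\leq k \leq d} b_{ijkl} \alpha^{d-k}$, and $B_{li}$ is the $d\times d$ matrix with entries $b_{ijkl}$ ($j$ indexing rows, $k$ columns). $\mathcal{D} \subset \mathbb{Q}(\alpha)\cap C_{r_1,r_2}^+$ is a fixed fundamental domain for the action of the totally positive units of $\mathbb{Z}[\alpha]$. *)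

theory Defs
  imports Complex_Main "HOL-Number_Theory.Cong" "Jordan_Normal_Form.Determinant"
begin

(* Vectors and matrices are those of Jordan_Normal_Form.Matrix, whose indices start at 0.
   Ideal classes and their representatives are numbered from 1. *)

definition Z_adj :: "complex \<Rightarrow> complex set" where
  "Z_adj \<alpha> = range (\<lambda>p :: int poly. poly (map_poly of_int p) \<alpha>)"

definition Q_adj :: "complex \<Rightarrow> complex set" where
  "Q_adj \<alpha> = {x / y | x y. x \<in> Z_adj \<alpha> \<and> y \<in> Z_adj \<alpha> \<and> y \<noteq> 0}"

definition field_embedding :: "complex \<Rightarrow> (complex \<Rightarrow> complex) \<Rightarrow> bool" where
  "field_embedding \<alpha> \<tau> \<longleftrightarrow> \<tau> 1 = 1 \<and>
     (\<forall>x \<in> Q_adj \<alpha>. \<forall>y \<in> Q_adj \<alpha>. \<tau> (x + y) = \<tau> x + \<tau> y \<and> \<tau> (x * y) = \<tau> x * \<tau> y)"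

definition real_embedding :: "complex \<Rightarrow> (complex \<Rightarrow> complex) \<Rightarrow> bool" where
  "real_embedding \<alpha> \<tau> \<longleftrightarrow> (\<forall>x \<in> Q_adj \<alpha>. \<tau> x \<in> \<real>)"

text \<open>The vector of embeddings; an element of \<open>\<rat>(\<alpha>)\<close> is identified with it.\<close>

definition emb_vec :: "(nat \<Rightarrow> complex \<Rightarrow> complex) \<Rightarrow> nat \<Rightarrow> complex \<Rightarrow> complex vec" where
  "emb_vec \<sigma> d x = vec d (\<lambda>j. \<sigma> j x)"

definition C_space :: "nat \<Rightarrow> nat \<Rightarrow> complex vec set" where
  "C_space r1 r2 = {v \<in> carrier_vec (r1 + 2 * r2).
     (\<forall>j < r1. v $ j \<in> \<real>) \<and> (\<forall>k < r2. v $ (r1 + 2 * k + 1) = cnj (v $ (r1 + 2 * k)))}"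

definition C_pos :: "nat \<Rightarrow> nat \<Rightarrow> complex vec set" where
  "C_pos r1 r2 = {v \<in> C_space r1 r2. \<forall>j < r1. Re (v $ j) > 0}"

text \<open>\<open>\<sigma> 0, \<dots>, \<sigma> (d - 1)\<close> lists every embedding of \<open>\<rat>(\<alpha>)\<close> exactly once, up to the
  irrelevant values outside \<open>\<rat>(\<alpha>)\<close>, in the order prescribed by \<open>C_space\<close>.\<close>

definition embedding_list ::
  "complex \<Rightarrow> nat \<Rightarrow> nat \<Rightarrow> nat \<Rightarrow> (nat \<Rightarrow> complex \<Rightarrow> complex) \<Rightarrow> bool" where
  "embedding_list \<alpha> d r1 r2 \<sigma> \<longleftrightarrow>
     (\<forall>j < d. field_embedding \<alpha> (\<sigma> j)) \<and>
     (\<forall>\<tau>. field_embedding \<alpha> \<tau> \<longrightarrow> (\<exists>!j. j < d \<and> (\<forall>x \<in> Q_adj \<alpha>. \<tau> x = \<sigma> j x))) \<and>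
     card {j. j < d \<and> real_embedding \<alpha> (\<sigma> j)} = r1 \<and>
     card {j. j < d \<and> \<not> real_embedding \<alpha> (\<sigma> j)} = 2 * r2 \<and>
     (\<forall>x \<in> Q_adj \<alpha>. emb_vec \<sigma> d x \<in> C_space r1 r2)"

text \<open>\<open>\<rat>(\<alpha>) \<inter> C\<^sup>+\<close>. It contains 0 exactly if there is no real embedding.\<close>

definition K_pos :: "complex \<Rightarrow> nat \<Rightarrow> nat \<Rightarrow> (nat \<Rightarrow> complex \<Rightarrow> complex) \<Rightarrow> complex set" where
  "K_pos \<alpha> r1 r2 \<sigma> = {x \<in> Q_adj \<alpha>. emb_vec \<sigma> (r1 + 2 * r2) x \<in> C_pos r1 r2}"

definition pos_units :: "complex \<Rightarrow> nat \<Rightarrow> nat \<Rightarrow> (nat \<Rightarrow> complex \<Rightarrow> complex) \<Rightarrow> complex set" where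
  "pos_units \<alpha> r1 r2 \<sigma> = {e \<in> Z_adj \<alpha> \<inter> K_pos \<alpha> r1 r2 \<sigma>. \<exists>e' \<in> Z_adj \<alpha>. e * e' = 1}"

text \<open>Without real embeddings a fundamental domain may or may not contain the fixed point 0.\<close>

definition fundamental_domain ::
  "complex \<Rightarrow> nat \<Rightarrow> nat \<Rightarrow> (nat \<Rightarrow> complex \<Rightarrow> complex) \<Rightarrow> complex set \<Rightarrow> bool" where
  "fundamental_domain \<alpha> r1 r2 \<sigma> D \<longleftrightarrow> D \<subseteq> K_pos \<alpha> r1 r2 \<sigma> \<and>
     (\<forall>x \<in> K_pos \<alpha> r1 r2 \<sigma> - {0}. \<exists>!y. y \<in> D \<and> (\<exists>e \<in> pos_units \<alpha> r1 r2 \<sigma>. y = e * x))"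

definition fractional_ideal :: "complex \<Rightarrow> complex set \<Rightarrow> bool" where
  "fractional_ideal \<alpha> I \<longleftrightarrow> I \<subseteq> Q_adj \<alpha> \<and> 0 \<in> I \<and> I \<noteq> {0} \<and>
     (\<forall>x \<in> I. \<forall>y \<in> I. x + y \<in> I) \<and> (\<forall>r \<in> Z_adj \<alpha>. \<forall>x \<in> I. r * x \<in> I) \<and>
     (\<exists>a \<in> Z_adj \<alpha>. a \<noteq> 0 \<and> (\<forall>x \<in> I. a * x \<in> Z_adj \<alpha>))"

definition ideal_mult :: "complex set \<Rightarrow> complex set \<Rightarrow> complex set" where
  "ideal_mult I J =
     {\<Sum>k<n. x k * y k | (n :: nat) x y. \<forall>k<n. x k \<in> I \<and> y k \<in> J}"

definition invertible_ideal :: "complex \<Rightarrow> complex set \<Rightarrow> bool" where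
  "invertible_ideal \<alpha> I \<longleftrightarrow> fractional_ideal \<alpha> I \<and>
     (\<exists>J. fractional_ideal \<alpha> J \<and> ideal_mult I J = Z_adj \<alpha>)"

text \<open>For invertible \<open>I\<close> this is the only fractional ideal whose product with \<open>I\<close> is \<open>\<int>[\<alpha>]\<close>.\<close>

definition ideal_inv :: "complex \<Rightarrow> complex set \<Rightarrow> complex set" where
  "ideal_inv \<alpha> I = {x \<in> Q_adj \<alpha>. \<forall>y \<in> I. x * y \<in> Z_adj \<alpha>}"

definition narrow_rel ::
  "complex \<Rightarrow> nat \<Rightarrow> nat \<Rightarrow> (nat \<Rightarrow> complex \<Rightarrow> complex) \<Rightarrow> (complex set \<times> complex set) set" where
  "narrow_rel \<alpha> r1 r2 \<sigma> = {(I, J). invertible_ideal \<alpha> I \<and> invertible_ideal \<alpha> J \<and>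
     (\<exists>x \<in> K_pos \<alpha> r1 r2 \<sigma> - {0}. I = (\<lambda>y. x * y) ` J)}"

definition narrow_classes ::
  "complex \<Rightarrow> nat \<Rightarrow> nat \<Rightarrow> (nat \<Rightarrow> complex \<Rightarrow> complex) \<Rightarrow> complex set set set" where
  "narrow_classes \<alpha> r1 r2 \<sigma> = {I. invertible_ideal \<alpha> I} // narrow_rel \<alpha> r1 r2 \<sigma>"

definition narrow_class_number ::
  "complex \<Rightarrow> nat \<Rightarrow> nat \<Rightarrow> (nat \<Rightarrow> complex \<Rightarrow> complex) \<Rightarrow> nat" where
  "narrow_class_number \<alpha> r1 r2 \<sigma> = card (narrow_classes \<alpha> r1 r2 \<sigma>)"

definition narrow_representatives ::
  "complex \<Rightarrow> nat \<Rightarrow> nat \<Rightarrow> (nat \<Rightarrow> complex \<Rightarrow> complex) \<Rightarrow> (nat \<Rightarrow> complex set) \<Rightarrow> bool" where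
  "narrow_representatives \<alpha> r1 r2 \<sigma> I \<longleftrightarrow>
     (\<forall>l \<in> {1..narrow_class_number \<alpha> r1 r2 \<sigma>}. invertible_ideal \<alpha> (I l) \<and> I l \<subseteq> Z_adj \<alpha>) \<and>
     bij_betw (\<lambda>l. narrow_rel \<alpha> r1 r2 \<sigma> `` {I l})
       {1..narrow_class_number \<alpha> r1 r2 \<sigma>} (narrow_classes \<alpha> r1 r2 \<sigma>) \<and>
     I 1 = Z_adj \<alpha>"

definition Z_basis :: "nat \<Rightarrow> (nat \<Rightarrow> complex) \<Rightarrow> complex set \<Rightarrow> bool" where
  "Z_basis d b I \<longleftrightarrow> I = range (\<lambda>z :: nat \<Rightarrow> int. \<Sum>i<d. of_int (z i) * b i) \<and>
     (\<forall>z :: nat \<Rightarrow> int. (\<Sum>i<d. of_int (z i) * b i) = 0 \<longrightarrow> (\<forall>i<d. z i = 0))"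

definition SL_int :: "nat \<Rightarrow> int mat set" where
  "SL_int d = {A \<in> carrier_mat d d. det A = 1}"

definition basis_mat :: "nat \<Rightarrow> (nat \<Rightarrow> complex \<Rightarrow> complex) \<Rightarrow> (nat \<Rightarrow> complex) \<Rightarrow> complex mat" where
  "basis_mat d \<sigma> b = mat d d (\<lambda>(i, j). \<sigma> j (b i))"

text \<open>For fixed \<open>l\<close> the integer \<open>b\<^sub>i\<^sub>j\<^sub>k\<^sub>l\<close> is written \<open>b i j k\<close>.\<close>

definition B_mat :: "nat \<Rightarrow> (nat \<Rightarrow> nat \<Rightarrow> nat \<Rightarrow> int) \<Rightarrow> nat \<Rightarrow> int mat" where
  "B_mat d b i = mat d d (\<lambda>(j, k). b i j k)"

definition C_mat :: "nat \<Rightarrow> (nat \<Rightarrow> nat \<Rightarrow> nat \<Rightarrow> int) \<Rightarrow> int vec \<Rightarrow> int mat" where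
  "C_mat d b c = mat d d (\<lambda>(j, k). \<Sum>i<d. c $ i * B_mat d b i $$ (j, k))"

definition xi :: "nat \<Rightarrow> (nat \<Rightarrow> complex) \<Rightarrow> int vec \<Rightarrow> complex" where
  "xi d bbar c = (\<Sum>i<d. of_int (c $ i) * bbar i)"

definition minor_det :: "nat \<Rightarrow> int mat \<Rightarrow> nat \<Rightarrow> int" where
  "minor_det d C j = det (mat_delete C j (d - 1))"

text \<open>With indices from 0, the sign \<open>(-1)\<^sup>j\<^sup>+\<^sup>d\<close> becomes \<open>(-1)\<^sup>j\<^sup>+\<^sup>1\<^sup>+\<^sup>d\<close>.\<close>

definition bezout_vec :: "nat \<Rightarrow> int mat \<Rightarrow> int vec \<Rightarrow> bool" where
  "bezout_vec d C u \<longleftrightarrow> u \<in> carrier_vec d \<and>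
     (\<Sum>j<d. (-1) ^ ((j + 1) + d) * u $ j * minor_det d C j) = 1"

definition gamma_inv :: "nat \<Rightarrow> int mat \<Rightarrow> int vec \<Rightarrow> int mat" where
  "gamma_inv d C u = mat d d (\<lambda>(i, j). if j < d - 1 then C $$ (i, j) else u $ i)"

text \<open>The entries \<open>\<mu>\<^sup>d\<^sup>-\<^sup>1, \<dots>, \<mu>\<close> of the last column are representatives of residue classes
  modulo \<open>m\<close>, not literally powers of one integer: \<open>w\<close> is the vector of these representatives.\<close>

definition power_reps :: "nat \<Rightarrow> int \<Rightarrow> int \<Rightarrow> int vec \<Rightarrow> bool" where
  "power_reps d m \<mu> w \<longleftrightarrow> w \<in> carrier_vec (d - 1) \<and>
     (\<forall>i < d - 1. [w $ i = \<mu> ^ (d - 1 - i)] (mod m))"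

definition root_mat :: "nat \<Rightarrow> int \<Rightarrow> int vec \<Rightarrow> int mat" where
  "root_mat d m w = mat d d (\<lambda>(i, j).
     if j < d - 1 then (if i = j then 1 else 0) else (if i < d - 1 then - (w $ i) else m))"

text \<open>\<open>B1\<close> and \<open>Bl\<close> are the matrices \<open>\<BB>\<^sub>1\<close> and \<open>\<BB>\<^sub>l\<close> of embedded bases
  (\<open>basis_mat\<close> applied to the bases of \<open>I\<^sub>1\<close> and \<open>I\<^sub>l\<close>).\<close>

definition gamma_equations ::
  "nat \<Rightarrow> (nat \<Rightarrow> complex \<Rightarrow> complex) \<Rightarrow> complex mat \<Rightarrow> complex mat \<Rightarrow> int mat \<Rightarrow> complex \<Rightarrow>
   int vec \<Rightarrow> int \<Rightarrow> int vec \<Rightarrow> bool" where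
  "gamma_equations d \<sigma> B1 Bl C \<xi> u m w \<longleftrightarrow>
     (\<exists>\<gamma> \<in> SL_int d.
        \<gamma> * gamma_inv d C u = 1\<^sub>m d \<and> gamma_inv d C u * \<gamma> = 1\<^sub>m d \<and>
        map_mat of_int \<gamma> * Bl * mat_diag d (\<lambda>j. \<sigma> j \<xi>) = map_mat of_int (root_mat d m w) * B1 \<and>
        root_mat d m w = \<gamma> * C)"

text \<open>The entries of the matrix \<open>M\<close> applied to the column \<open>(\<alpha>\<^sup>d\<^sup>-\<^sup>1, \<dots>, \<alpha>, 1)\<close>.\<close>

definition rows_at :: "nat \<Rightarrow> complex \<Rightarrow> int mat \<Rightarrow> nat \<Rightarrow> complex" where
  "rows_at d \<alpha> M i = (\<Sum>j<d. of_int (M $$ (i, j)) * \<alpha> ^ (d - 1 - j))"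

definition admissible ::
  "nat \<Rightarrow> (nat \<Rightarrow> complex) \<Rightarrow> (nat \<Rightarrow> nat \<Rightarrow> nat \<Rightarrow> int) \<Rightarrow> complex set \<Rightarrow> int vec \<Rightarrow> bool" where
  "admissible d bbar b D c \<longleftrightarrow> c \<in> carrier_vec d \<and> xi d bbar c \<in> D \<and>
     Gcd (minor_det d (C_mat d b c) ` {..<d}) = 1"

end

(* Since beta'_i beta_j is expanded in the power basis, xi beta_l = C (alpha^(d-1), ..., 1)^T: the rows of C
   are a basis of xi I_l in power coordinates, and det C > 0 by total positivity of xi and orientation.
   The Bezout condition says det gamma^-1 = 1, and the equation for gamma amounts to C = gamma^-1 R with R
   the matrix of the root; so it says that xi I_l is the ideal with basis R (alpha^(d-1), ..., 1)^T.
   This ideal meets the integers in m Z and contains alpha - mu, whence F(mu) = 0 modulo m.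
   Conversely an invertible ideal J determines its narrow class, hence l, and J = xi I_l determines xi up to
   a totally positive unit, hence uniquely in the fundamental domain; a unimodular change of basis gives gamma. *)

theory Submission
  imports Defs
begin

subsection \<open>Integer combinations\<close>

text \<open>The complex matrix identity is removed early: the embeddings of
  \<open>\<xi> * \<beta> i\<close> give \<open>C * B1 = Bl * diag\<close>, so everything is decided
  by the integral equation \<open>gamma_inv d C u * root_mat d m w = C\<close>. In its first
  \<open>d - 1\<close> columns this equation is automatic, because those columns of the root matrix
  are unit vectors. What remains is a linear relation between \<open>u\<close> and \<open>w\<close>
  in the last column, which is why Bezout vectors and representatives of the residues determine each
  other, while \<open>m\<close> is forced to be \<open>det C\<close>.

  Three obstacles shape the rest. The order \<open>Z_adj \<alpha>\<close> need not be maximal, so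
  passing from equal scaled ideals to a unit uses that an invertible ideal has no multipliers
  outside the order. Determinants of embedded bases need not be real, so orientation is an equality
  of complex signs. Without real embeddings 0 counts as totally positive, so
  \<open>\<xi> = 0\<close> has to be excluded by the Bezout condition.\<close>

lemma int_comb_subset:
  fixes b b' :: "nat \<Rightarrow> complex" and M :: "nat \<Rightarrow> nat \<Rightarrow> int"
  assumes "\<And>i. i < d \<Longrightarrow> b' i = (\<Sum>j<d. of_int (M i j) * b j)"
  shows "range (\<lambda>z :: nat \<Rightarrow> int. \<Sum>i<d. of_int (z i) * b' i)
       \<subseteq> range (\<lambda>z :: nat \<Rightarrow> int. \<Sum>i<d. of_int (z i) * b i)"
proof clarify
  fix z :: "nat \<Rightarrow> int"
  have "(\<Sum>i<d. of_int (z i) * b' i) = (\<Sum>i<d. \<Sum>j<d. of_int (z i * M i j) * b j)"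
    using assms by (simp add: sum_distrib_left mult.assoc)
  also have "\<dots> = (\<Sum>j<d. of_int (\<Sum>i<d. z i * M i j) * b j)"
    by (subst sum.swap) (simp add: sum_distrib_right)
  finally show "(\<Sum>i<d. of_int (z i) * b' i) \<in> range (\<lambda>z :: nat \<Rightarrow> int. \<Sum>i<d. of_int (z i) * b i)"
    by (intro range_eqI[where x = "\<lambda>j. \<Sum>i<d. z i * M i j"]) simp
qed

lemma Z_basis_range: "Z_basis d b I \<Longrightarrow> I = range (\<lambda>z :: nat \<Rightarrow> int. \<Sum>i<d. of_int (z i) * b i)"
  by (simp add: Z_basis_def)

lemma Z_basis_coeff_eq:
  assumes "Z_basis d b I" "(\<Sum>i<d. of_int (z i) * b i) = (\<Sum>i<d. of_int (z' i) * b i)" "i < d"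
  shows "z i = z' i"
proof -
  have "(\<Sum>i<d. of_int (z i - z' i) * b i) = 0"
    using assms(2) by (simp add: left_diff_distrib sum_subtractf)
  moreover have "\<forall>z. (\<Sum>i<d. of_int (z i) * b i) = 0 \<longrightarrow> (\<forall>i<d. z i = 0)"
    using assms(1) unfolding Z_basis_def by blast
  ultimately have "\<forall>i<d. z i - z' i = 0" by (elim allE[where x = "\<lambda>i. z i - z' i"]) simp
  then show ?thesis using assms(3) by auto
qed

lemma Z_basis_mem:
  assumes "Z_basis d b I" "i < d"
  shows "b i \<in> I"
proof -
  have "b i = (\<Sum>j<d. of_int (if j = i then 1 else 0) * b j)"
    using assms(2) by (simp add: if_distrib[of "\<lambda>x. of_int x * _"] sum.delta cong: if_cong)
  then show ?thesis unfolding Z_basis_range[OF assms(1)] by (rule range_eqI[where x = "\<lambda>j. if j = i then 1 else 0"])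
qed

lemma Z_basis_coeffs:
  assumes "Z_basis d b I" "\<And>i. i < d \<Longrightarrow> b' i \<in> I"
  obtains A where "A \<in> carrier_mat d d" "\<And>i. i < d \<Longrightarrow> b' i = (\<Sum>j<d. of_int (A $$ (i, j)) * b j)"
proof -
  have "\<forall>i. \<exists>z :: nat \<Rightarrow> int. i < d \<longrightarrow> b' i = (\<Sum>j<d. of_int (z j) * b j)"
    using assms(2) unfolding Z_basis_range[OF assms(1)] by blast
  then obtain z :: "nat \<Rightarrow> nat \<Rightarrow> int"
    where z: "\<And>i. i < d \<Longrightarrow> b' i = (\<Sum>j<d. of_int (z i j) * b j)" by metis
  show ?thesis
    by (rule that[of "mat d d (\<lambda>(i, j). z i j)"]) (use z in auto)
qed

lemma mat_mult_entry:
  "A \<in> carrier_mat n k \<Longrightarrow> B \<in> carrier_mat k m \<Longrightarrow> i < n \<Longrightarrow> j < m \<Longrightarrow>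
    (A * B) $$ (i, j) = (\<Sum>l<k. A $$ (i, l) * B $$ (l, j))"
  by (simp add: scalar_prod_def atLeast0LessThan)

lemma int_comb_mult:
  fixes b b' :: "nat \<Rightarrow> complex"
  assumes A: "A \<in> carrier_mat d d" and B: "B \<in> carrier_mat d d"
    and b': "\<And>i. i < d \<Longrightarrow> b' i = (\<Sum>j<d. of_int (B $$ (i, j)) * b j)"
    and i: "i < d"
  shows "(\<Sum>j<d. of_int (A $$ (i, j)) * b' j) = (\<Sum>j<d. of_int ((A * B) $$ (i, j)) * b j)"
proof -
  have "(\<Sum>j<d. of_int (A $$ (i, j)) * b' j) = (\<Sum>l<d. \<Sum>j<d. of_int (A $$ (i, l) * B $$ (l, j)) * b j)"
    using b' by (simp add: sum_distrib_left mult.assoc)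
  also have "\<dots> = (\<Sum>j<d. of_int ((A * B) $$ (i, j)) * b j)"
    using i by (subst sum.swap) (simp add: mat_mult_entry[OF A B] sum_distrib_right)
  finally show ?thesis .
qed

text \<open>Coordinates in a basis are unique, so equations between algebraic numbers can be read as
  equations between integer matrices.\<close>

lemma Z_basis_mat_eq:
  assumes "Z_basis d b I" "A \<in> carrier_mat d d" "B \<in> carrier_mat d d"
    "\<And>i. i < d \<Longrightarrow> (\<Sum>j<d. of_int (A $$ (i, j)) * b j) = (\<Sum>j<d. of_int (B $$ (i, j)) * b j)"
  shows "A = B"
proof (rule eq_matI)
  fix i j assume "i < dim_row B" "j < dim_col B"
  then show "A $$ (i, j) = B $$ (i, j)"
    using Z_basis_coeff_eq[OF assms(1,4), of i j] assms(3) by simp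
qed (use assms(2,3) in auto)

text \<open>Expressing each basis in the other and substituting writes a basis in terms of itself;
  uniqueness of coordinates turns both products of the coefficient matrices into the
  identity.\<close>

lemma Z_basis_change:
  assumes b: "Z_basis d b I" and b': "Z_basis d b' I"
  obtains A B where "A \<in> carrier_mat d d" "B \<in> carrier_mat d d" "A * B = 1\<^sub>m d" "B * A = 1\<^sub>m d"
    "\<And>i. i < d \<Longrightarrow> b' i = (\<Sum>j<d. of_int (A $$ (i, j)) * b j)"
proof -
  obtain A where A: "A \<in> carrier_mat d d" "\<And>i. i < d \<Longrightarrow> b' i = (\<Sum>j<d. of_int (A $$ (i, j)) * b j)"
    using Z_basis_coeffs[OF b] Z_basis_mem[OF b'] by metis
  obtain B where B: "B \<in> carrier_mat d d" "\<And>i. i < d \<Longrightarrow> b i = (\<Sum>j<d. of_int (B $$ (i, j)) * b' j)"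
    using Z_basis_coeffs[OF b'] Z_basis_mem[OF b] by metis
  have one: "(\<Sum>j<d. of_int (1\<^sub>m d $$ (i, j)) * c j) = c i" if "i < d" for i and c :: "nat \<Rightarrow> complex"
    using that by (simp add: if_distrib[of "\<lambda>x. of_int x * _"] sum.delta cong: if_cong)
  have "A * B = 1\<^sub>m d"
  proof (rule Z_basis_mat_eq[OF b'])
    fix i assume i: "i < d"
    show "(\<Sum>j<d. of_int ((A * B) $$ (i, j)) * b' j) = (\<Sum>j<d. of_int (1\<^sub>m d $$ (i, j)) * b' j)"
      using int_comb_mult[where b = b' and b' = b, OF A(1) B(1) B(2) i] A(2)[OF i] one[OF i, of b'] by simp
  qed (use A B in auto)
  moreover have "B * A = 1\<^sub>m d"
  proof (rule Z_basis_mat_eq[OF b])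
    fix i assume i: "i < d"
    show "(\<Sum>j<d. of_int ((B * A) $$ (i, j)) * b j) = (\<Sum>j<d. of_int (1\<^sub>m d $$ (i, j)) * b j)"
      using int_comb_mult[where b = b and b' = b', OF B(1) A(1) A(2) i] B(2)[OF i] one[OF i, of b] by simp
  qed (use A B in auto)
  ultimately show ?thesis using that A B by blast
qed

text \<open>Induction with the two-term identity: the new element gets the coefficient
  \<open>x\<close> and all earlier coefficients are scaled by \<open>y\<close>.\<close>

lemma bezout_family:
  fixes f :: "nat \<Rightarrow> int"
  shows "\<exists>u. (\<Sum>j<n. u j * f j) = Gcd (f ` {..<n})"
proof (induction n)
  case (Suc n)
  then obtain u where u: "(\<Sum>j<n. u j * f j) = Gcd (f ` {..<n})" by blast
  obtain x y where xy: "x * f n + y * Gcd (f ` {..<n}) = gcd (f n) (Gcd (f ` {..<n}))"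
    using bezout_int by blast
  have "(\<Sum>j<n. (if j = n then x else y * u j) * f j) = y * (\<Sum>j<n. u j * f j)"
    by (simp add: sum_distrib_left mult.assoc)
  then show ?case
    using u xy by (intro exI[of _ "\<lambda>j. if j = n then x else y * u j"]) (simp add: lessThan_Suc)
qed simp

subsection \<open>Bezout vectors and factorizations by unimodular matrices\<close>

lemma gamma_inv_carrier [simp]: "gamma_inv d C u \<in> carrier_mat d d"
  and root_mat_carrier [simp]: "root_mat d m w \<in> carrier_mat d d"
  and C_mat_carrier [simp]: "C_mat d b c \<in> carrier_mat d d"
  and basis_mat_carrier [simp]: "basis_mat d \<sigma> x \<in> carrier_mat d d"
  by (auto simp: gamma_inv_def root_mat_def C_mat_def basis_mat_def)

text \<open>Expansion along the last column: deleting that column removes \<open>u\<close>, so the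
  minors are those of \<open>C\<close> and the Bezout sum is a determinant.\<close>

lemma det_gamma_inv:
  assumes "0 < d" "C \<in> carrier_mat d d"
  shows "det (gamma_inv d C u) = (\<Sum>j<d. (-1) ^ ((j + 1) + d) * u $ j * minor_det d C j)"
proof -
  have del: "mat_delete (gamma_inv d C u) j (d - 1) = mat_delete C j (d - 1)" if "j < d" for j
    using assms that by (intro eq_matI) (auto simp: mat_delete_def gamma_inv_def)
  \<comment> \<open>The exponents differ by 2; \<open>0 < d\<close> is what makes this true for the
    truncated \<open>d - 1\<close>.\<close>
  have sgn: "(-1 :: int) ^ (j + (d - 1)) = (-1) ^ ((j + 1) + d)" for j
    using assms(1) by (cases d) auto
  have "det (gamma_inv d C u) =
      (\<Sum>j<d. gamma_inv d C u $$ (j, d - 1) * cofactor (gamma_inv d C u) j (d - 1))"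
    using assms by (intro laplace_expansion_column) auto
  also have "\<dots> = (\<Sum>j<d. (-1) ^ ((j + 1) + d) * u $ j * minor_det d C j)"
  proof (rule sum.cong[OF refl])
    fix j assume j: "j \<in> {..<d}"
    then have "gamma_inv d C u $$ (j, d - 1) = u $ j"
      using assms(1) by (simp add: gamma_inv_def)
    then show "gamma_inv d C u $$ (j, d - 1) * cofactor (gamma_inv d C u) j (d - 1) =
        (-1) ^ ((j + 1) + d) * u $ j * minor_det d C j"
      using j by (simp only: cofactor_def del sgn minor_det_def lessThan_iff mult.assoc mult.left_commute)
  qed
  finally show ?thesis .
qed

lemma bezout_iff_det:
  assumes "0 < d" "C \<in> carrier_mat d d" "u \<in> carrier_vec d"
  shows "bezout_vec d C u \<longleftrightarrow> det (gamma_inv d C u) = 1"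
  using assms by (simp add: bezout_vec_def det_gamma_inv)

lemma bezout_imp_SL:
  assumes "0 < d" "C \<in> carrier_mat d d" "bezout_vec d C u"
  shows "gamma_inv d C u \<in> SL_int d"
  using assms bezout_iff_det[of d C u] by (auto simp: SL_int_def bezout_vec_def)

lemma bezout_imp_Gcd:
  assumes "bezout_vec d C u"
  shows "Gcd (minor_det d C ` {..<d}) = 1"
proof -
  let ?g = "Gcd (minor_det d C ` {..<d})"
  have "?g dvd (\<Sum>j<d. (-1) ^ ((j + 1) + d) * u $ j * minor_det d C j)"
    by (intro dvd_sum dvd_mult Gcd_dvd) auto
  then have "?g dvd 1" using assms by (simp add: bezout_vec_def)
  then show ?thesis by (metis Gcd_int_greater_eq_0 abs_of_nonneg zdvd1_eq)
qed

lemma Gcd_imp_bezout: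
  assumes "Gcd (minor_det d C ` {..<d}) = 1"
  shows "\<exists>u. bezout_vec d C u"
proof -
  obtain v where v: "(\<Sum>j<d. v j * minor_det d C j) = 1"
    using bezout_family[of "minor_det d C" d] assms by auto
  \<comment> \<open>The signs of the expansion are absorbed into the coefficients, since each sign
    squares to 1.\<close>
  have "(\<Sum>j<d. (-1) ^ ((j + 1) + d) * ((-1) ^ ((j + 1) + d) * v j) * minor_det d C j) = 1"
    using v by (simp flip: mult.assoc power_add mult_2_right)
  then show ?thesis
    by (intro exI[of _ "vec d (\<lambda>j. (-1) ^ ((j + 1) + d) * v j)"]) (simp add: bezout_vec_def)
qed

lemma det_root_mat:
  assumes "0 < d"
  shows "det (root_mat d m w) = m"
proof -
  obtain n where d: "d = Suc n" using assms by (cases d) auto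
  have "det (root_mat d m w) = prod_list (diag_mat (root_mat d m w))"
    using assms by (intro det_upper_triangular[where n = d]) (auto simp: root_mat_def)
  also have "diag_mat (root_mat d m w) = map (\<lambda>i. 1) [0..<n] @ [m]"
    by (simp add: diag_mat_def root_mat_def d)
  also have "prod_list \<dots> = m" by (simp add: map_replicate_const)
  finally show ?thesis .
qed

text \<open>For determinant 1 the adjugate is an integral inverse.\<close>

lemma SL_int_inverse:
  assumes "A \<in> SL_int d"
  obtains B where "B \<in> SL_int d" "A * B = 1\<^sub>m d" "B * A = 1\<^sub>m d"
proof -
  have A: "A \<in> carrier_mat d d" "det A = 1" using assms by (auto simp: SL_int_def)
  have inv: "A * adj_mat A = 1\<^sub>m d" "adj_mat A * A = 1\<^sub>m d"
    using adj_mat(2,3)[OF A(1)] A(2) by auto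
  have "det A * det (adj_mat A) = 1"
    using inv(1) det_mult[OF A(1) adj_mat(1)[OF A(1)]] by simp
  then have "adj_mat A \<in> SL_int d" using A adj_mat(1)[OF A(1)] by (simp add: SL_int_def)
  then show ?thesis using inv that by blast
qed

text \<open>Since the first \<open>d - 1\<close> columns of the root matrix are unit vectors,
  multiplying by it on the right keeps those columns and mixes only the last one.\<close>

lemma gamma_inv_times_root_mat:
  assumes "0 < d" "i < d" "j < d"
  shows "(gamma_inv d C u * root_mat d m w) $$ (i, j) =
    (if j < d - 1 then C $$ (i, j) else m * u $ i - (\<Sum>k<d - 1. C $$ (i, k) * w $ k))"
proof -
  obtain n where d: "d = Suc n" using assms by (cases d) auto
  have "(gamma_inv d C u * root_mat d m w) $$ (i, j) =
      (\<Sum>k<n. C $$ (i, k) * root_mat d m w $$ (k, j)) + u $ i * root_mat d m w $$ (n, j)"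
    using assms d
    by (subst mat_mult_entry[OF gamma_inv_carrier root_mat_carrier])
      (simp_all add: gamma_inv_def)
  also have "\<dots> = (if j < d - 1 then C $$ (i, j) else m * u $ i - (\<Sum>k<d - 1. C $$ (i, k) * w $ k))"
  proof (cases "j < n")
    case True
    have "(\<Sum>k<n. C $$ (i, k) * root_mat d m w $$ (k, j)) = (\<Sum>k<n. if k = j then C $$ (i, k) else 0)"
      using True d by (intro sum.cong) (auto simp: root_mat_def)
    moreover have "root_mat d m w $$ (n, j) = 0" using True d by (simp add: root_mat_def)
    ultimately show ?thesis using True d by simp
  next
    case False
    have "(\<Sum>k<n. C $$ (i, k) * root_mat d m w $$ (k, j)) = (\<Sum>k<n. - (C $$ (i, k) * w $ k))"
      using False d assms by (intro sum.cong) (auto simp: root_mat_def)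
    moreover have "root_mat d m w $$ (n, j) = m" using False d assms by (simp add: root_mat_def)
    ultimately show ?thesis using False d by (simp add: sum_negf)
  qed
  finally show ?thesis .
qed

text \<open>Only the last column carries a condition: one equation per row, linear in
  \<open>u\<close> and \<open>w\<close>. It is later solved for \<open>u\<close> with
  \<open>w\<close> prescribed.\<close>

lemma gamma_inv_times_root_mat_eq_iff:
  assumes "0 < d" "C \<in> carrier_mat d d"
  shows "gamma_inv d C u * root_mat d m w = C \<longleftrightarrow>
    (\<forall>i<d. C $$ (i, d - 1) = m * u $ i - (\<Sum>k<d - 1. C $$ (i, k) * w $ k))"
proof -
  have "gamma_inv d C u * root_mat d m w = C \<longleftrightarrow>
      (\<forall>i<d. \<forall>j<d. (gamma_inv d C u * root_mat d m w) $$ (i, j) = C $$ (i, j))"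
    using assms(2) mult_carrier_mat[OF gamma_inv_carrier root_mat_carrier, of d C u m w] by (auto intro!: eq_matI)
  also have "\<dots> \<longleftrightarrow> (\<forall>i<d. C $$ (i, d - 1) = m * u $ i - (\<Sum>k<d - 1. C $$ (i, k) * w $ k))"
  proof (intro iffI allI impI)
    fix i assume "\<forall>i<d. \<forall>j<d. (gamma_inv d C u * root_mat d m w) $$ (i, j) = C $$ (i, j)" "i < d"
    then have "(gamma_inv d C u * root_mat d m w) $$ (i, d - 1) = C $$ (i, d - 1)" using assms(1) by simp
    then show "C $$ (i, d - 1) = m * u $ i - (\<Sum>k<d - 1. C $$ (i, k) * w $ k)"
      using assms(1) \<open>i < d\<close> by (simp add: gamma_inv_times_root_mat)
  next
    fix i j assume "\<forall>i<d. C $$ (i, d - 1) = m * u $ i - (\<Sum>k<d - 1. C $$ (i, k) * w $ k)" "i < d" "j < d"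
    moreover have "j = d - 1" if "\<not> j < d - 1" using that \<open>j < d\<close> by simp
    ultimately show "(gamma_inv d C u * root_mat d m w) $$ (i, j) = C $$ (i, j)"
      using assms(1) by (auto simp: gamma_inv_times_root_mat)
  qed
  finally show ?thesis .
qed

lemma root_mat_inj:
  assumes "root_mat d m w = root_mat d m w'" "w \<in> carrier_vec (d - 1)" "w' \<in> carrier_vec (d - 1)"
  shows "w = w'"
proof (rule eq_vecI)
  fix i assume "i < dim_vec w'"
  then have "i < d - 1" using assms(3) by simp
  moreover have "root_mat d m w $$ (i, d - 1) = root_mat d m w' $$ (i, d - 1)" using assms(1) by simp
  ultimately show "w $ i = w' $ i" by (simp add: root_mat_def)
qed (use assms in auto)

text \<open>By \<open>CB\<close> the identity with the embeddings is
  \<open>root_mat d m w = \<gamma> * C\<close> multiplied by \<open>B1\<close> on the right, so only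
  the integral factorization has to be studied from here on.\<close>

lemma gamma_equations_iff:
  assumes "0 < d" "C \<in> carrier_mat d d" "Bl \<in> carrier_mat d d" "B1 \<in> carrier_mat d d"
    and CB: "map_mat of_int C * B1 = Bl * mat_diag d (\<lambda>j. \<sigma> j \<xi>)"
    and u: "bezout_vec d C u"
  shows "gamma_equations d \<sigma> B1 Bl C \<xi> u m w \<longleftrightarrow> gamma_inv d C u * root_mat d m w = C"
proof
  assume "gamma_equations d \<sigma> B1 Bl C \<xi> u m w"
  then obtain \<gamma> where \<gamma>: "\<gamma> \<in> carrier_mat d d" "gamma_inv d C u * \<gamma> = 1\<^sub>m d" "root_mat d m w = \<gamma> * C"
    by (auto simp: gamma_equations_def SL_int_def)
  have "gamma_inv d C u * root_mat d m w = (gamma_inv d C u * \<gamma>) * C"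
    unfolding \<gamma>(3) by (rule assoc_mult_mat[OF gamma_inv_carrier \<gamma>(1) assms(2), symmetric])
  then show "gamma_inv d C u * root_mat d m w = C" using \<gamma> assms(2) by simp
next
  assume eq: "gamma_inv d C u * root_mat d m w = C"
  obtain \<gamma> where \<gamma>: "\<gamma> \<in> SL_int d" "gamma_inv d C u * \<gamma> = 1\<^sub>m d" "\<gamma> * gamma_inv d C u = 1\<^sub>m d"
    using SL_int_inverse[OF bezout_imp_SL[OF assms(1,2) u]] by metis
  then have \<gamma>c: "\<gamma> \<in> carrier_mat d d" by (simp add: SL_int_def)
  have "\<gamma> * C = (\<gamma> * gamma_inv d C u) * root_mat d m w"
    using \<gamma>c eq by (simp add: assoc_mult_mat[of _ d d _ d _ d])
  then have root: "root_mat d m w = \<gamma> * C" using \<gamma> left_mult_one_mat[OF root_mat_carrier] by simp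
  have "map_mat of_int \<gamma> * Bl * mat_diag d (\<lambda>j. \<sigma> j \<xi>) =
      map_mat of_int \<gamma> * (map_mat of_int C * B1)"
    using \<gamma>c assms(3) unfolding CB by (simp add: assoc_mult_mat[of _ d d _ d _ d] mat_diag_dim)
  also have "\<dots> = map_mat of_int \<gamma> * map_mat of_int C * B1"
    using \<gamma>c assms(2,4) by (simp add: assoc_mult_mat[of _ d d _ d _ d])
  also have "map_mat of_int \<gamma> * map_mat of_int C = map_mat of_int (root_mat d m w)"
    unfolding root using \<gamma>c assms(2)
    by (simp add: of_int_hom.mat_hom_mult[where n = d and nr = d and nc = d])
  finally show "gamma_equations d \<sigma> B1 Bl C \<xi> u m w"
    unfolding gamma_equations_def using \<gamma> root by blast
qed

lemma det_of_factorization: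
  assumes "0 < d" "C \<in> carrier_mat d d" "gamma_inv d C u * root_mat d m w = C"
  shows "det C = det (gamma_inv d C u) * m"
  using det_mult[OF gamma_inv_carrier root_mat_carrier, of d C u m w] assms det_root_mat by metis

subsection \<open>The ring and field generated by an algebraic number\<close>

lemma Z_adjI: "poly (map_poly of_int p) \<alpha> \<in> Z_adj \<alpha>"
  by (simp add: Z_adj_def)

lemma Z_adj_of_int [simp]: "of_int n \<in> Z_adj \<alpha>"
  using Z_adjI[of "[:n:]" \<alpha>] by (simp add: map_poly_pCons)

lemma Z_adj_0 [simp]: "0 \<in> Z_adj \<alpha>" and Z_adj_1 [simp]: "1 \<in> Z_adj \<alpha>"
  using Z_adj_of_int[of 0 \<alpha>] Z_adj_of_int[of 1 \<alpha>] by simp_all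

lemma Z_adj_gen [simp]: "\<alpha> \<in> Z_adj \<alpha>"
  using Z_adjI[of "[:0, 1:]" \<alpha>] by (simp add: map_poly_pCons)

lemma Z_adj_add: "x \<in> Z_adj \<alpha> \<Longrightarrow> y \<in> Z_adj \<alpha> \<Longrightarrow> x + y \<in> Z_adj \<alpha>"
proof -
  have "map_poly of_int (p + q) = (map_poly of_int p + map_poly of_int q :: complex poly)" for p q
    by (rule poly_eqI) (simp add: coeff_map_poly)
  then have "poly (map_poly of_int p) \<alpha> + poly (map_poly of_int q) \<alpha> \<in> Z_adj \<alpha>" for p q
    using Z_adjI[of "p + q" \<alpha>] by simp
  then show "x \<in> Z_adj \<alpha> \<Longrightarrow> y \<in> Z_adj \<alpha> \<Longrightarrow> x + y \<in> Z_adj \<alpha>"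
    by (auto simp: Z_adj_def[of \<alpha>])
qed

lemma Z_adj_mult: "x \<in> Z_adj \<alpha> \<Longrightarrow> y \<in> Z_adj \<alpha> \<Longrightarrow> x * y \<in> Z_adj \<alpha>"
proof -
  have "map_poly of_int (p * q) = (map_poly of_int p * map_poly of_int q :: complex poly)" for p q
    by (rule poly_eqI) (simp add: coeff_map_poly coeff_mult)
  then have "poly (map_poly of_int p) \<alpha> * poly (map_poly of_int q) \<alpha> \<in> Z_adj \<alpha>" for p q
    using Z_adjI[of "p * q" \<alpha>] by simp
  then show "x \<in> Z_adj \<alpha> \<Longrightarrow> y \<in> Z_adj \<alpha> \<Longrightarrow> x * y \<in> Z_adj \<alpha>"
    by (auto simp: Z_adj_def[of \<alpha>])
qed

lemma Z_adj_sum: "(\<And>i. i \<in> A \<Longrightarrow> f i \<in> Z_adj \<alpha>) \<Longrightarrow> sum f A \<in> Z_adj \<alpha>"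
  by (induction A rule: infinite_finite_induct) (auto intro: Z_adj_add)

lemma Z_adj_power: "x \<in> Z_adj \<alpha> \<Longrightarrow> x ^ n \<in> Z_adj \<alpha>"
  by (induction n) (auto intro: Z_adj_mult)

lemma Z_adj_subset_Q_adj: "x \<in> Z_adj \<alpha> \<Longrightarrow> x \<in> Q_adj \<alpha>"
  unfolding Q_adj_def by (intro CollectI exI[of _ x] exI[of _ 1]) simp

lemma Q_adj_1 [simp]: "1 \<in> Q_adj \<alpha>" and Q_adj_0 [simp]: "0 \<in> Q_adj \<alpha>"
  and Q_adj_of_int [simp]: "of_int n \<in> Q_adj \<alpha>" and Q_adj_gen [simp]: "\<alpha> \<in> Q_adj \<alpha>"
  by (simp_all add: Z_adj_subset_Q_adj)

lemma Q_adjE: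
  assumes "x \<in> Q_adj \<alpha>"
  obtains p q where "p \<in> Z_adj \<alpha>" "q \<in> Z_adj \<alpha>" "q \<noteq> 0" "x = p / q"
  using assms unfolding Q_adj_def by blast

lemma Q_adjI: "p \<in> Z_adj \<alpha> \<Longrightarrow> q \<in> Z_adj \<alpha> \<Longrightarrow> q \<noteq> 0 \<Longrightarrow> p / q \<in> Q_adj \<alpha>"
  unfolding Q_adj_def by blast

lemma Q_adj_mult: "x \<in> Q_adj \<alpha> \<Longrightarrow> y \<in> Q_adj \<alpha> \<Longrightarrow> x * y \<in> Q_adj \<alpha>"
proof -
  assume "x \<in> Q_adj \<alpha>" "y \<in> Q_adj \<alpha>"
  then obtain p q r s where *: "p \<in> Z_adj \<alpha>" "q \<in> Z_adj \<alpha>" "q \<noteq> 0" "x = p / q"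
    "r \<in> Z_adj \<alpha>" "s \<in> Z_adj \<alpha>" "s \<noteq> 0" "y = r / s"
    by (elim Q_adjE)
  then show "x * y \<in> Q_adj \<alpha>"
    using Q_adjI[of "p * r" \<alpha> "q * s"] by (simp add: Z_adj_mult)
qed

lemma Q_adj_add: "x \<in> Q_adj \<alpha> \<Longrightarrow> y \<in> Q_adj \<alpha> \<Longrightarrow> x + y \<in> Q_adj \<alpha>"
proof -
  assume "x \<in> Q_adj \<alpha>" "y \<in> Q_adj \<alpha>"
  then obtain p q r s where *: "p \<in> Z_adj \<alpha>" "q \<in> Z_adj \<alpha>" "q \<noteq> 0" "x = p / q"
    "r \<in> Z_adj \<alpha>" "s \<in> Z_adj \<alpha>" "s \<noteq> 0" "y = r / s"
    by (elim Q_adjE)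
  then show "x + y \<in> Q_adj \<alpha>"
    using Q_adjI[of "p * s + r * q" \<alpha> "q * s"] by (simp add: Z_adj_mult Z_adj_add add_frac_eq)
qed

lemma Q_adj_inverse: "x \<in> Q_adj \<alpha> \<Longrightarrow> inverse x \<in> Q_adj \<alpha>"
proof (cases "x = 0")
  assume "x \<in> Q_adj \<alpha>" "x \<noteq> 0"
  then obtain p q where *: "p \<in> Z_adj \<alpha>" "q \<in> Z_adj \<alpha>" "q \<noteq> 0" "x = p / q"
    by (elim Q_adjE)
  then show ?thesis using Q_adjI[of q \<alpha> p] \<open>x \<noteq> 0\<close> by simp
qed simp

lemma Q_adj_sum: "(\<And>i. i \<in> A \<Longrightarrow> f i \<in> Q_adj \<alpha>) \<Longrightarrow> sum f A \<in> Q_adj \<alpha>"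
  by (induction A rule: infinite_finite_induct) (auto intro: Q_adj_add)

subsection \<open>Embeddings\<close>

context
  fixes \<alpha> :: complex and \<tau> :: "complex \<Rightarrow> complex"
  assumes \<tau>: "field_embedding \<alpha> \<tau>"
begin

lemma embedding_add: "x \<in> Q_adj \<alpha> \<Longrightarrow> y \<in> Q_adj \<alpha> \<Longrightarrow> \<tau> (x + y) = \<tau> x + \<tau> y"
  and embedding_mult: "x \<in> Q_adj \<alpha> \<Longrightarrow> y \<in> Q_adj \<alpha> \<Longrightarrow> \<tau> (x * y) = \<tau> x * \<tau> y"
  and embedding_1: "\<tau> 1 = 1"
  using \<tau> by (auto simp: field_embedding_def)

lemma embedding_0: "\<tau> 0 = 0"
  using embedding_add[of 0 0] by simp

lemma embedding_uminus: "x \<in> Q_adj \<alpha> \<Longrightarrow> \<tau> (- x) = - \<tau> x"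
  using embedding_add[of x "-x"] embedding_0 Q_adj_mult[OF Q_adj_of_int[of "-1"], of x]
  by (simp add: eq_neg_iff_add_eq_0 add.commute)

lemma embedding_sum: "(\<And>i. i \<in> A \<Longrightarrow> f i \<in> Q_adj \<alpha>) \<Longrightarrow> \<tau> (sum f A) = (\<Sum>i\<in>A. \<tau> (f i))"
  by (induction A rule: infinite_finite_induct) (auto simp: embedding_0 embedding_add Q_adj_sum)

lemma embedding_power: "x \<in> Q_adj \<alpha> \<Longrightarrow> \<tau> (x ^ n) = \<tau> x ^ n \<and> x ^ n \<in> Q_adj \<alpha>"
  by (induction n) (auto simp: embedding_1 embedding_mult Q_adj_mult)

lemma embedding_of_nat: "\<tau> (of_nat n) = of_nat n"
proof (induction n)
  case (Suc n)
  then show ?case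
    using embedding_add[of 1 "of_nat n"] embedding_1 Q_adj_of_int[of "int n" \<alpha>] by simp
qed (simp add: embedding_0)

lemma embedding_of_int: "\<tau> (of_int n) = of_int n"
  using embedding_uminus[of "of_nat (nat (- n))"] Q_adj_of_int[of "-n" \<alpha>]
    embedding_of_nat[of "nat n"] embedding_of_nat[of "nat (- n)"]
  by (cases "n \<ge> 0") auto

lemma embedding_poly: "\<tau> (poly (map_poly of_int p) \<alpha>) = poly (map_poly of_int p) (\<tau> \<alpha>)"
proof (induction p)
  case (pCons a p)
  have "poly (map_poly of_int p) \<alpha> \<in> Q_adj \<alpha>" by (intro Z_adj_subset_Q_adj Z_adjI)
  then show ?case
    using pCons by (simp add: map_poly_pCons embedding_add embedding_mult embedding_of_int Q_adj_mult)
qed (simp add: embedding_0)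

lemma embedding_nonzero: "x \<in> Q_adj \<alpha> \<Longrightarrow> x \<noteq> 0 \<Longrightarrow> \<tau> x \<noteq> 0"
  using embedding_mult[of x "inverse x"] embedding_1 by (auto simp: Q_adj_inverse)

lemma embedding_inverse: "x \<in> Q_adj \<alpha> \<Longrightarrow> \<tau> (inverse x) = inverse (\<tau> x)"
proof (cases "x = 0")
  assume x: "x \<in> Q_adj \<alpha>" "x \<noteq> 0"
  then have "\<tau> x * \<tau> (inverse x) = 1"
    using embedding_mult[of x "inverse x"] embedding_1 by (simp add: Q_adj_inverse)
  then show ?thesis by (simp add: inverse_unique)
qed (simp add: embedding_0)

end

text \<open>Elements of the field are quotients of integer polynomials in \<open>\<alpha>\<close>,
  so the image of \<open>\<alpha>\<close> determines an embedding.\<close>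

lemma embedding_eqI:
  assumes "field_embedding \<alpha> \<tau>" "field_embedding \<alpha> \<tau>'" "\<tau> \<alpha> = \<tau>' \<alpha>" "x \<in> Q_adj \<alpha>"
  shows "\<tau> x = \<tau>' x"
proof -
  obtain p q where pq: "p \<in> Z_adj \<alpha>" "q \<in> Z_adj \<alpha>" "x = p / q"
    using assms(4) by (elim Q_adjE)
  have eq: "\<tau> y = \<tau>' y" if "y \<in> Z_adj \<alpha>" for y
    using that assms(1-3) by (auto simp: Z_adj_def embedding_poly)
  have "p \<in> Q_adj \<alpha>" "q \<in> Q_adj \<alpha>" using pq Z_adj_subset_Q_adj by auto
  then show ?thesis
    using assms(1,2) pq eq by (simp add: divide_inverse embedding_mult embedding_inverse Q_adj_inverse)
qed

text \<open>The sign of a complex number is \<open>z / |z|\<close>. Taking signs on both sides,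
  those of \<open>z\<close> and \<open>w\<close> cancel and leave the sign of the integer
  \<open>n\<close>.\<close>

lemma sgn_pos_eq:
  fixes z w :: complex and n :: int and r :: real
  assumes "of_int n * z = w * of_real r" "r > 0" "sgn w = sgn z" "z \<noteq> 0"
  shows "n > 0"
proof -
  have "sgn (of_int n :: complex) * sgn z = sgn w * sgn (of_real r)"
    using assms(1) by (metis sgn_mult)
  then have "sgn (of_int n :: complex) = 1" using assms(2-4) by (simp add: sgn_of_real sgn_zero_iff)
  then have "complex_of_real (sgn (real_of_int n)) = complex_of_real 1"
    by (metis of_real_of_int_eq of_real_1 sgn_of_real)
  then have "sgn (real_of_int n) = 1" by (simp only: of_real_eq_iff)
  then show ?thesis by (simp add: sgn_1_pos)
qed

text \<open>A kernel vector of the transpose is the coefficient list of a nonzero polynomial of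
  degree below \<open>d\<close> vanishing at \<open>d\<close> distinct points.\<close>

lemma det_power_mat_nonzero:
  fixes x :: "nat \<Rightarrow> complex"
  assumes "inj_on x {..<d}"
  shows "det (mat d d (\<lambda>(i, j). x j ^ (d - 1 - i))) \<noteq> 0"
proof
  let ?A = "mat d d (\<lambda>(i, j). x j ^ (d - 1 - i))"
  assume "det ?A = 0"
  then have "det ?A\<^sup>T = 0" by (simp add: det_transpose[of _ d])
  then obtain v where v: "v \<in> carrier_vec d" "v \<noteq> 0\<^sub>v d" "?A\<^sup>T *\<^sub>v v = 0\<^sub>v d"
    using det_0_iff_vec_prod_zero[of "?A\<^sup>T" d] by auto
  define p where "p = (\<Sum>i<d. monom (v $ i) (d - 1 - i))"
  have coeff: "coeff p (d - 1 - i) = v $ i" if "i < d" for i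
  proof -
    have "coeff p (d - 1 - i) = (\<Sum>k<d. if k = i then v $ k else 0)"
      unfolding p_def coeff_sum using that by (intro sum.cong) auto
    then show ?thesis using that by simp
  qed
  obtain i where "i < d" "v $ i \<noteq> 0" using v by (metis carrier_vecD eq_vecI index_zero_vec)
  then have p: "p \<noteq> 0" using coeff[of i] by auto
  have "degree p \<le> d - 1"
    unfolding p_def by (intro degree_sum_le) (auto intro: order.trans[OF degree_monom_le])
  moreover have "card {z. poly p z = 0} \<ge> d"
  proof -
    have "poly p (x j) = 0" if "j < d" for j
    proof -
      have "poly p (x j) = (?A\<^sup>T *\<^sub>v v) $ j"
        using that v(1)
        by (auto simp: p_def poly_sum poly_monom scalar_prod_def atLeast0LessThan mult.commute intro!: sum.cong)
      then show ?thesis unfolding v(3) using that by simp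
    qed
    then have "x ` {..<d} \<subseteq> {z. poly p z = 0}" by auto
    then have "card (x ` {..<d}) \<le> card {z. poly p z = 0}"
      using p by (intro card_mono poly_roots_finite)
    then show ?thesis using card_image[OF assms] by simp
  qed
  ultimately have "d \<le> d - 1" using card_poly_roots_bound[OF p] by linarith
  \<comment> \<open>With truncated subtraction \<open>d \<le> d - 1\<close> is true for
    \<open>d = 0\<close>; the index \<open>i < d\<close> rules this case out.\<close>
  then show False using \<open>i < d\<close> by linarith
qed

text \<open>Each conjugate pair contributes the factor \<open>|z|^2\<close>, positive because no
  entry vanishes; the induction adds one pair at a time.\<close>

lemma prod_pos_real:
  fixes x :: "nat \<Rightarrow> complex"
  assumes "\<And>j. j < n \<Longrightarrow> x j \<in> \<real>" "\<And>j. j < n \<Longrightarrow> Re (x j) > 0"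
    "\<And>k. k < m \<Longrightarrow> x (n + 2 * k + 1) = cnj (x (n + 2 * k))"
    "\<And>j. j < n + 2 * m \<Longrightarrow> x j \<noteq> 0"
  shows "\<exists>r>0. (\<Prod>j<n + 2 * m. x j) = complex_of_real r"
  using assms
proof (induction m)
  case 0
  have "(\<Prod>j<n. x j) = (\<Prod>j<n. complex_of_real (Re (x j)))"
    using 0 by (intro prod.cong) (auto simp: of_real_Re)
  then show ?case using 0 by (intro exI[of _ "\<Prod>j<n. Re (x j)"]) (auto intro!: prod_pos)
next
  case (Suc m)
  then obtain r where r: "r > 0" "(\<Prod>j<n + 2 * m. x j) = complex_of_real r" by auto
  have "(\<Prod>j<n + 2 * Suc m. x j) = (\<Prod>j<n + 2 * m. x j) * (x (n + 2 * m) * x (n + 2 * m + 1))"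
    by (simp add: mult.assoc)
  also have "\<dots> = complex_of_real (r * (cmod (x (n + 2 * m)))\<^sup>2)"
    using Suc.prems(3)[of m] r(2) complex_norm_square[of "x (n + 2 * m)"] by simp
  finally show ?case using Suc.prems(4)[of "n + 2 * m"] r
    by (intro exI[of _ "r * (cmod (x (n + 2 * m)))\<^sup>2"]) auto
qed

subsection \<open>The lattice attached to a root modulo \<open>m\<close>\<close>

text \<open>On power coordinates this is the kernel of the additive map to the integers modulo
  \<open>m\<close> that sends 1 to 1 and \<open>\<alpha> ^ (d - 1 - i)\<close> to
  \<open>w $ i\<close>. In this form it is visible that only the residues of \<open>w\<close>
  matter.\<close>

definition root_lattice :: "nat \<Rightarrow> complex \<Rightarrow> int \<Rightarrow> int vec \<Rightarrow> complex set" where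
  "root_lattice d \<alpha> m w = {\<Sum>k<d. of_int (z k) * \<alpha> ^ (d - 1 - k) | z :: nat \<Rightarrow> int.
     m dvd z (d - 1) + (\<Sum>i<d - 1. z i * w $ i)}"

lemma rows_at_root_mat:
  assumes "i < d"
  shows "rows_at d \<alpha> (root_mat d m w) i = (if i < d - 1 then \<alpha> ^ (d - 1 - i) - of_int (w $ i) else of_int m)"
proof -
  obtain n where d: "d = Suc n" using assms by (cases d) auto
  have "(\<Sum>j<n. of_int (root_mat d m w $$ (i, j)) * \<alpha> ^ (n - j)) =
      (\<Sum>j<n. if j = i then \<alpha> ^ (n - j) else 0)"
    using assms d by (intro sum.cong) (auto simp: root_mat_def)
  then have "rows_at d \<alpha> (root_mat d m w) i =
      (if i < n then \<alpha> ^ (n - i) else 0) + of_int (root_mat d m w $$ (i, n))"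
    using d by (simp add: rows_at_def)
  then show ?thesis using assms d by (simp add: root_mat_def)
qed

text \<open>The coefficients of the first \<open>d - 1\<close> rows are the first
  \<open>d - 1\<close> power coordinates, and the quotient \<open>t\<close> in the congruence is the
  coefficient of the last row, which is \<open>m\<close>.\<close>

lemma root_lattice_eq_range:
  assumes "0 < d"
  shows "root_lattice d \<alpha> m w =
    range (\<lambda>z :: nat \<Rightarrow> int. \<Sum>i<d. of_int (z i) * rows_at d \<alpha> (root_mat d m w) i)"
proof -
  obtain n where d: "d = Suc n" using assms by (cases d) auto
  have comb: "(\<Sum>i<d. of_int (z i) * rows_at d \<alpha> (root_mat d m w) i) =
      (\<Sum>k<n. of_int (z k) * \<alpha> ^ (n - k)) + of_int (z n * m - (\<Sum>i<n. z i * w $ i))" for z :: "nat \<Rightarrow> int"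
  proof -
    have "(\<Sum>i<n. of_int (z i) * rows_at d \<alpha> (root_mat d m w) i) =
        (\<Sum>i<n. of_int (z i) * (\<alpha> ^ (n - i) - of_int (w $ i)))"
      using d by (intro sum.cong) (auto simp: rows_at_root_mat)
    also have "\<dots> = (\<Sum>k<n. of_int (z k) * \<alpha> ^ (n - k)) - of_int (\<Sum>i<n. z i * w $ i)"
      by (simp add: right_diff_distrib sum_subtractf)
    finally show ?thesis using d by (simp add: rows_at_root_mat)
  qed
  show ?thesis
  proof (intro equalityI subsetI)
    fix x assume "x \<in> root_lattice d \<alpha> m w"
    then obtain z where z: "x = (\<Sum>k<d. of_int (z k) * \<alpha> ^ (d - 1 - k))"
      "m dvd z (d - 1) + (\<Sum>i<d - 1. z i * w $ i)" unfolding root_lattice_def by blast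
    then obtain t where t: "z n + (\<Sum>i<n. z i * w $ i) = m * t" using d by (auto elim: dvdE)
    have "x = (\<Sum>k<n. of_int (z k) * \<alpha> ^ (n - k)) + of_int (z n)" using z d by simp
    also have "z n = t * m - (\<Sum>i<n. z i * w $ i)" using t by (simp add: algebra_simps)
    also have "(\<Sum>k<n. of_int (z k) * \<alpha> ^ (n - k)) + of_int (t * m - (\<Sum>i<n. z i * w $ i)) =
        (\<Sum>i<d. of_int ((z(n := t)) i) * rows_at d \<alpha> (root_mat d m w) i)"
      unfolding comb by (simp cong: sum.cong_simp)
    finally show "x \<in> range (\<lambda>z :: nat \<Rightarrow> int. \<Sum>i<d. of_int (z i) * rows_at d \<alpha> (root_mat d m w) i)"
      by (rule range_eqI[where x = "z(n := t)"])
  next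
    fix x assume "x \<in> range (\<lambda>z :: nat \<Rightarrow> int. \<Sum>i<d. of_int (z i) * rows_at d \<alpha> (root_mat d m w) i)"
    then obtain z :: "nat \<Rightarrow> int" where "x = (\<Sum>i<d. of_int (z i) * rows_at d \<alpha> (root_mat d m w) i)" by blast
    then have "x = (\<Sum>k<d. of_int ((z(n := z n * m - (\<Sum>i<n. z i * w $ i))) k) * \<alpha> ^ (d - 1 - k))"
      unfolding comb using d by simp
    then show "x \<in> root_lattice d \<alpha> m w"
      unfolding root_lattice_def using d
      by (intro CollectI exI[of _ "z(n := z n * m - (\<Sum>i<n. z i * w $ i))"]) simp
  qed
qed

lemma root_lattice_cong:
  assumes "power_reps d m \<mu> w" "power_reps d m \<mu> w'"
  shows "root_lattice d \<alpha> m w = root_lattice d \<alpha> m w'"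
proof -
  have w: "[w $ i = w' $ i] (mod m)" if "i < d - 1" for i
    using assms that cong_trans cong_sym unfolding power_reps_def by blast
  have "[z (d - 1) + (\<Sum>i<d - 1. z i * w $ i) = z (d - 1) + (\<Sum>i<d - 1. z i * w' $ i)] (mod m)"
    for z :: "nat \<Rightarrow> int"
    by (intro cong_add cong_sum cong_mult cong_refl w) simp
  then have "m dvd z (d - 1) + (\<Sum>i<d - 1. z i * w $ i) \<longleftrightarrow> m dvd z (d - 1) + (\<Sum>i<d - 1. z i * w' $ i)"
    for z :: "nat \<Rightarrow> int"
    by (rule cong_dvd_iff)
  then show ?thesis by (simp add: root_lattice_def)
qed

subsection \<open>Multiplication of lattices\<close>

text \<open>Multiply an expression of 1 as a sum of products from \<open>L\<close> and its inverse
  by \<open>e\<close>: the factors from \<open>L\<close> stay in \<open>L\<close>, so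
  \<open>e\<close> lies in the product, which is the order.\<close>

lemma invertible_ideal_multiplier:
  assumes "invertible_ideal \<alpha> L" "\<And>x. x \<in> L \<Longrightarrow> e * x \<in> L"
  shows "e \<in> Z_adj \<alpha>"
proof -
  obtain J where J: "ideal_mult L J = Z_adj \<alpha>" using assms(1) by (auto simp: invertible_ideal_def)
  then have "1 \<in> ideal_mult L J" by simp
  then obtain n :: nat and x y where xy: "1 = (\<Sum>k<n. x k * y k)" "\<forall>k<n. x k \<in> L \<and> y k \<in> J"
    unfolding ideal_mult_def by blast
  have "e = e * (\<Sum>k<n. x k * y k)" using xy(1) by simp
  also have "\<dots> = (\<Sum>k<n. (e * x k) * y k)" by (simp add: sum_distrib_left mult.assoc)
  finally have "e \<in> ideal_mult L J"
    using xy(2) assms(2) unfolding ideal_mult_def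
    by (intro CollectI exI[of _ n] exI[of _ "\<lambda>k. e * x k"] exI[of _ y]) simp
  then show ?thesis using J by simp
qed

lemma Z_basis_scale:
  assumes "Z_basis d b L" "y \<noteq> 0"
  shows "Z_basis d (\<lambda>i. y * b i) ((\<lambda>x. y * x) ` L)"
proof -
  have comb: "(\<Sum>i<d. of_int (z i) * (y * b i)) = y * (\<Sum>i<d. of_int (z i) * b i)" for z :: "nat \<Rightarrow> int"
    by (simp add: sum_distrib_left mult.left_commute)
  show ?thesis
    using assms by (auto simp: Z_basis_def comb image_image)
qed

subsection \<open>Total positivity\<close>

text \<open>The power basis is a parameter of the setting because the main theorem obtains it from
  the given basis of \<open>I 1\<close>, not from \<open>F\<close>.\<close>

locale embedded_order =
  fixes \<alpha> :: complex and d r1 r2 :: nat and \<sigma> :: "nat \<Rightarrow> complex \<Rightarrow> complex"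
  assumes d_pos: "0 < d" and embeddings: "embedding_list \<alpha> d r1 r2 \<sigma>"
    and powers: "Z_basis d (\<lambda>i. \<alpha> ^ (d - 1 - i)) (Z_adj \<alpha>)"
begin

lemma embedding: "j < d \<Longrightarrow> field_embedding \<alpha> (\<sigma> j)"
  using embeddings by (simp add: embedding_list_def)

lemma emb_vec_C_space: "x \<in> Q_adj \<alpha> \<Longrightarrow> emb_vec \<sigma> d x \<in> C_space r1 r2"
  using embeddings by (simp add: embedding_list_def)

lemma d_eq: "d = r1 + 2 * r2"
proof -
  have "emb_vec \<sigma> d 1 \<in> carrier_vec (r1 + 2 * r2)"
    using emb_vec_C_space[OF Q_adj_1] unfolding C_space_def by blast
  then show ?thesis unfolding emb_vec_def by (metis carrier_vecD dim_vec)
qed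

lemma real_coord:
  assumes "x \<in> Q_adj \<alpha>" "j < r1"
  shows "\<sigma> j x \<in> \<real>"
proof -
  have "emb_vec \<sigma> d x $ j \<in> \<real>"
    using emb_vec_C_space[OF assms(1)] assms(2) unfolding C_space_def by blast
  then show ?thesis using assms(2) d_eq by (simp add: emb_vec_def)
qed

lemma cnj_coord:
  assumes "x \<in> Q_adj \<alpha>" "k < r2"
  shows "\<sigma> (r1 + 2 * k + 1) x = cnj (\<sigma> (r1 + 2 * k) x)"
proof -
  have "emb_vec \<sigma> d x $ (r1 + 2 * k + 1) = cnj (emb_vec \<sigma> d x $ (r1 + 2 * k))"
    using emb_vec_C_space[OF assms(1)] assms(2) unfolding C_space_def by blast
  then show ?thesis using assms(2) d_eq by (simp add: emb_vec_def)
qed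

text \<open>The real and conjugate shape of the coordinates is shared by all field elements, so only
  the positivity at real embeddings remains.\<close>

lemma K_pos_iff: "x \<in> K_pos \<alpha> r1 r2 \<sigma> \<longleftrightarrow> x \<in> Q_adj \<alpha> \<and> (\<forall>j<r1. Re (\<sigma> j x) > 0)"
proof -
  have "(\<forall>j<r1. Re (emb_vec \<sigma> d x $ j) > 0) \<longleftrightarrow> (\<forall>j<r1. Re (\<sigma> j x) > 0)"
    using d_eq by (simp add: emb_vec_def)
  then show ?thesis
    unfolding K_pos_def C_pos_def d_eq[symmetric] using emb_vec_C_space by blast
qed

lemma K_pos_imp_Q_adj: "x \<in> K_pos \<alpha> r1 r2 \<sigma> \<Longrightarrow> x \<in> Q_adj \<alpha>"
  by (simp add: K_pos_iff)

lemma K_pos_1 [simp]: "1 \<in> K_pos \<alpha> r1 r2 \<sigma>"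
  using d_eq by (auto simp: K_pos_iff embedding_1[OF embedding])

lemma K_pos_mult:
  assumes "x \<in> K_pos \<alpha> r1 r2 \<sigma>" "y \<in> K_pos \<alpha> r1 r2 \<sigma>"
  shows "x * y \<in> K_pos \<alpha> r1 r2 \<sigma>"
proof -
  have "Re (\<sigma> j (x * y)) > 0" if "j < r1" for j
  proof -
    have "\<sigma> j (x * y) = \<sigma> j x * \<sigma> j y"
      using assms that d_eq embedding[of j] by (intro embedding_mult) (auto simp: K_pos_iff)
    moreover have "Re (\<sigma> j x) > 0" using assms that by (simp add: K_pos_iff)
    moreover have "Im (\<sigma> j x) = 0" using assms real_coord that by (auto simp: K_pos_iff complex_is_Real_iff)
    ultimately show ?thesis using assms that by (simp add: K_pos_iff)
  qed
  then show ?thesis using assms by (simp add: K_pos_iff Q_adj_mult)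
qed

lemma K_pos_inverse:
  assumes "x \<in> K_pos \<alpha> r1 r2 \<sigma>"
  shows "inverse x \<in> K_pos \<alpha> r1 r2 \<sigma>"
proof -
  have "Re (\<sigma> j (inverse x)) > 0" if "j < r1" for j
  proof -
    have "\<sigma> j (inverse x) = inverse (\<sigma> j x)"
      using assms that d_eq embedding[of j] by (intro embedding_inverse) (auto simp: K_pos_iff)
    moreover have "Re (\<sigma> j x) > 0" using assms that by (simp add: K_pos_iff)
    moreover have "Im (\<sigma> j x) = 0" using assms real_coord that by (auto simp: K_pos_iff complex_is_Real_iff)
    ultimately show ?thesis by simp
  qed
  then show ?thesis using assms by (simp add: K_pos_iff Q_adj_inverse)
qed

text \<open>Two listed embeddings with the same value at \<open>\<alpha>\<close> agree on the whole
  field, and the list contains each embedding only once.\<close>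

lemma embeddings_distinct: "inj_on (\<lambda>j. \<sigma> j \<alpha>) {..<d}"
proof (rule inj_onI)
  fix i j assume ij: "i \<in> {..<d}" "j \<in> {..<d}" "\<sigma> i \<alpha> = \<sigma> j \<alpha>"
  then have "\<forall>x \<in> Q_adj \<alpha>. \<sigma> i x = \<sigma> j x"
    using embedding_eqI[OF embedding[of i] embedding[of j]] by (metis lessThan_iff)
  moreover have "\<exists>!k. k < d \<and> (\<forall>x \<in> Q_adj \<alpha>. \<sigma> i x = \<sigma> k x)"
    using embeddings embedding[of i] ij(1) by (simp add: embedding_list_def)
  ultimately show "i = j" using ij by blast
qed

lemma det_powers_nonzero: "det (basis_mat d \<sigma> (\<lambda>i. \<alpha> ^ (d - 1 - i))) \<noteq> 0"
proof -
  have "basis_mat d \<sigma> (\<lambda>i. \<alpha> ^ (d - 1 - i)) = mat d d (\<lambda>(i, j). \<sigma> j \<alpha> ^ (d - 1 - i))"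
    unfolding basis_mat_def using embedding_power[OF embedding Q_adj_gen]
    by (intro cong_mat) auto
  then show ?thesis using det_power_mat_nonzero[OF embeddings_distinct] by simp
qed

lemma norm_pos:
  assumes "x \<in> K_pos \<alpha> r1 r2 \<sigma>" "x \<noteq> 0"
  shows "\<exists>r>0. (\<Prod>j<d. \<sigma> j x) = complex_of_real r"
  unfolding d_eq
proof (rule prod_pos_real)
  show "\<sigma> j x \<noteq> 0" if "j < r1 + 2 * r2" for j
    using embedding_nonzero[OF embedding[of j]] that assms d_eq by (simp add: K_pos_iff)
qed (use assms K_pos_iff real_coord cnj_coord in blast)+

section \<open>Integers and shifted powers in the root lattice\<close>

lemma of_int_mem_root_lattice: "of_int n \<in> root_lattice d \<alpha> m w \<longleftrightarrow> m dvd n"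
proof
  assume "of_int n \<in> root_lattice d \<alpha> m w"
  then obtain z where z: "of_int n = (\<Sum>k<d. of_int (z k) * \<alpha> ^ (d - 1 - k))"
    "m dvd z (d - 1) + (\<Sum>i<d - 1. z i * w $ i)" unfolding root_lattice_def by blast
  \<comment> \<open>The power coordinates of \<open>n\<close> vanish except the last. By uniqueness
    \<open>z\<close> is this vector, and the lattice congruence becomes
    \<open>m dvd n\<close>.\<close>
  have "(\<Sum>k<d. of_int (if k = d - 1 then n else 0) * \<alpha> ^ (d - 1 - k)) = (\<Sum>k<d. if k = d - 1 then of_int n else 0)"
    by (intro sum.cong) auto
  also have "\<dots> = of_int n" using d_pos by simp
  finally have eq: "z k = (if k = d - 1 then n else 0)" if "k < d" for k
    using Z_basis_coeff_eq[OF powers _ that, of z "\<lambda>k. if k = d - 1 then n else 0"] z(1) by simp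
  then have "(\<Sum>i<d - 1. z i * w $ i) = 0" by (intro sum.neutral) auto
  then show "m dvd n" using z(2) eq[of "d - 1"] d_pos by simp
next
  assume "m dvd n"
  moreover have "of_int n = (\<Sum>k<d. of_int (if k = d - 1 then n else 0) * \<alpha> ^ (d - 1 - k))"
  proof -
    have "(\<Sum>k<d. of_int (if k = d - 1 then n else 0) * \<alpha> ^ (d - 1 - k)) = (\<Sum>k<d. if k = d - 1 then of_int n else 0)"
      by (intro sum.cong) auto
    also have "\<dots> = of_int n" using d_pos by simp
    finally show ?thesis by simp
  qed
  ultimately show "of_int n \<in> root_lattice d \<alpha> m w"
    unfolding root_lattice_def by (intro CollectI exI[of _ "\<lambda>k. if k = d - 1 then n else 0"]) simp
qed

text \<open>This element is row \<open>i\<close> of the root matrix applied to the powers of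
  \<open>\<alpha>\<close>.\<close>

lemma power_diff_mem_root_lattice:
  assumes "i < d - 1"
  shows "\<alpha> ^ (d - 1 - i) - of_int (w $ i) \<in> root_lattice d \<alpha> m w"
proof -
  let ?r = "rows_at d \<alpha> (root_mat d m w)"
  have i: "i < d" using assms by simp
  have "(\<Sum>k<d. of_int (if k = i then 1 else 0) * ?r k) = (\<Sum>k<d. if k = i then ?r k else 0)"
    by (intro sum.cong) auto
  also have "\<dots> = ?r i" using i by simp
  finally have "?r i \<in> root_lattice d \<alpha> m w"
    unfolding root_lattice_eq_range[OF d_pos]
    by (intro range_eqI[where x = "\<lambda>k. if k = i then 1 else 0"]) simp
  then show ?thesis using assms i by (simp add: rows_at_root_mat)
qed

section \<open>Narrow equivalence of invertible ideals\<close>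

lemma equiv_narrow_rel: "equiv {L. invertible_ideal \<alpha> L} (narrow_rel \<alpha> r1 r2 \<sigma>)"
proof (rule equivI)
  show "narrow_rel \<alpha> r1 r2 \<sigma> \<subseteq> {L. invertible_ideal \<alpha> L} \<times> {L. invertible_ideal \<alpha> L}"
    by (auto simp: narrow_rel_def)
  show "refl_on {L. invertible_ideal \<alpha> L} (narrow_rel \<alpha> r1 r2 \<sigma>)"
    by (auto simp: refl_on_def narrow_rel_def intro!: bexI[of _ 1])
  show "sym (narrow_rel \<alpha> r1 r2 \<sigma>)"
  proof (rule symI)
    fix A B assume "(A, B) \<in> narrow_rel \<alpha> r1 r2 \<sigma>"
    then obtain x where x: "invertible_ideal \<alpha> A" "invertible_ideal \<alpha> B" "x \<in> K_pos \<alpha> r1 r2 \<sigma>" "x \<noteq> 0"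
      "A = (\<lambda>y. x * y) ` B" by (auto simp: narrow_rel_def)
    then have "B = (\<lambda>y. inverse x * y) ` A" by (simp add: image_image flip: mult.assoc)
    then show "(B, A) \<in> narrow_rel \<alpha> r1 r2 \<sigma>"
      using x K_pos_inverse[of x] by (auto simp: narrow_rel_def intro!: bexI[of _ "inverse x"])
  qed
  show "trans (narrow_rel \<alpha> r1 r2 \<sigma>)"
  proof (rule transI)
    fix A B C assume "(A, B) \<in> narrow_rel \<alpha> r1 r2 \<sigma>" "(B, C) \<in> narrow_rel \<alpha> r1 r2 \<sigma>"
    then obtain x y where *: "invertible_ideal \<alpha> A" "invertible_ideal \<alpha> C"
      "x \<in> K_pos \<alpha> r1 r2 \<sigma>" "x \<noteq> 0" "A = (\<lambda>t. x * t) ` B"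
      "y \<in> K_pos \<alpha> r1 r2 \<sigma>" "y \<noteq> 0" "B = (\<lambda>t. y * t) ` C" by (auto simp: narrow_rel_def)
    then have "A = (\<lambda>t. (x * y) * t) ` C" by (simp add: image_image mult.assoc)
    then show "(A, C) \<in> narrow_rel \<alpha> r1 r2 \<sigma>"
      unfolding narrow_rel_def using * K_pos_mult[of x y]
      by (intro CollectI case_prodI conjI bexI[of _ "x * y"]) auto
  qed
qed

end

subsection \<open>Invertible ideals with fixed bases\<close>

locale order_ideal = embedded_order +
  fixes L :: "complex set" and \<beta> \<beta>' :: "nat \<Rightarrow> complex" and b :: "nat \<Rightarrow> nat \<Rightarrow> nat \<Rightarrow> int"
  assumes invertible: "invertible_ideal \<alpha> L" and basis: "Z_basis d \<beta> L"
    and orientation: "sgn (det (basis_mat d \<sigma> \<beta>)) = sgn (det (basis_mat d \<sigma> (\<lambda>i. \<alpha> ^ (d - 1 - i))))"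
    and basis_inv: "Z_basis d \<beta>' (ideal_inv \<alpha> L)"
    and structure_constants: "i < d \<Longrightarrow> j < d \<Longrightarrow>
      \<beta>' i * \<beta> j = (\<Sum>k<d. of_int (b i j k) * \<alpha> ^ (d - 1 - k))"
begin

abbreviation "C \<equiv> C_mat d b"
abbreviation "\<xi> \<equiv> xi d \<beta>'"

lemma ideal_subset_Q_adj: "x \<in> L \<Longrightarrow> x \<in> Q_adj \<alpha>"
  using invertible by (auto simp: invertible_ideal_def fractional_ideal_def)

lemma ideal_add: "x \<in> L \<Longrightarrow> y \<in> L \<Longrightarrow> x + y \<in> L"
  and ideal_mult_Z_adj: "r \<in> Z_adj \<alpha> \<Longrightarrow> x \<in> L \<Longrightarrow> r * x \<in> L"
  and ideal_0: "0 \<in> L"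
  using invertible by (auto simp: invertible_ideal_def fractional_ideal_def)

lemma xi_mem: "\<xi> c \<in> ideal_inv \<alpha> L"
  unfolding Z_basis_range[OF basis_inv] xi_def by blast

lemma xi_Q_adj: "\<xi> c \<in> Q_adj \<alpha>"
  using xi_mem by (simp add: ideal_inv_def)

lemma xi_mult_basis:
  assumes "i < d"
  shows "\<xi> c * \<beta> i = (\<Sum>k<d. of_int (C c $$ (i, k)) * \<alpha> ^ (d - 1 - k))"
proof -
  have "\<xi> c * \<beta> i = (\<Sum>a<d. \<Sum>k<d. of_int (c $ a * b a i k) * \<alpha> ^ (d - 1 - k))"
    unfolding xi_def using assms
    by (simp add: sum_distrib_right sum_distrib_left mult.assoc structure_constants)
  also have "\<dots> = (\<Sum>k<d. of_int (C c $$ (i, k)) * \<alpha> ^ (d - 1 - k))"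
    using assms by (subst sum.swap) (simp add: C_mat_def B_mat_def sum_distrib_right)
  finally show ?thesis .
qed

text \<open>Entry \<open>(i, j)\<close> on either side is
  \<open>\<sigma> j (\<xi> c * \<beta> i)\<close>, expanded in powers on the left and split as a
  product on the right.\<close>

lemma C_times_basis_mat:
  "map_mat of_int (C c) * basis_mat d \<sigma> (\<lambda>i. \<alpha> ^ (d - 1 - i)) =
    basis_mat d \<sigma> \<beta> * mat_diag d (\<lambda>j. \<sigma> j (\<xi> c))"
proof (rule eq_matI)
  fix i j
  assume "i < dim_row (basis_mat d \<sigma> \<beta> * mat_diag d (\<lambda>j. \<sigma> j (\<xi> c)))"
    and "j < dim_col (basis_mat d \<sigma> \<beta> * mat_diag d (\<lambda>j. \<sigma> j (\<xi> c)))"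
  then have ij: "i < d" "j < d" by (auto simp: basis_mat_def mat_diag_def)
  note \<sigma> = embedding[OF ij(2)]
  have "(map_mat of_int (C c) * basis_mat d \<sigma> (\<lambda>i. \<alpha> ^ (d - 1 - i))) $$ (i, j) =
      (\<Sum>k<d. of_int (C c $$ (i, k)) * \<sigma> j (\<alpha> ^ (d - 1 - k)))"
    using ij by (subst mat_mult_entry[where n = d and m = d and k = d]) (auto simp: basis_mat_def C_mat_def)
  also have "\<dots> = (\<Sum>k<d. \<sigma> j (of_int (C c $$ (i, k)) * \<alpha> ^ (d - 1 - k)))"
    using embedding_power[OF \<sigma> Q_adj_gen] embedding_of_int[OF \<sigma>]
    by (intro sum.cong) (auto simp: embedding_mult[OF \<sigma>])
  also have "\<dots> = \<sigma> j (\<xi> c * \<beta> i)"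
    unfolding xi_mult_basis[OF ij(1)] using embedding_power[OF \<sigma> Q_adj_gen]
    by (intro embedding_sum[OF \<sigma>, symmetric] Q_adj_mult) auto
  also have "\<dots> = \<sigma> j (\<beta> i) * \<sigma> j (\<xi> c)"
    using ideal_subset_Q_adj Z_basis_mem[OF basis ij(1)] xi_Q_adj
    by (simp add: embedding_mult[OF \<sigma>])
  also have "\<dots> = (basis_mat d \<sigma> \<beta> * mat_diag d (\<lambda>j. \<sigma> j (\<xi> c))) $$ (i, j)"
    using ij by (subst mat_diag_mult_right[where nr = d]) (auto simp: basis_mat_def)
  finally show "(map_mat of_int (C c) * basis_mat d \<sigma> (\<lambda>i. \<alpha> ^ (d - 1 - i))) $$ (i, j) =
      (basis_mat d \<sigma> \<beta> * mat_diag d (\<lambda>j. \<sigma> j (\<xi> c))) $$ (i, j)" .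
qed (auto simp: basis_mat_def C_mat_def mat_diag_def)

text \<open>The orientation of the bases and the total positivity of \<open>\<xi>\<close> fix the sign.\<close>

lemma det_C_pos:
  assumes "\<xi> c \<in> K_pos \<alpha> r1 r2 \<sigma>" "\<xi> c \<noteq> 0"
  shows "det (C c) > 0"
proof -
  obtain r where r: "r > 0" "(\<Prod>j<d. \<sigma> j (\<xi> c)) = complex_of_real r"
    using norm_pos[OF assms] by blast
  have "det (mat_diag d (\<lambda>j. \<sigma> j (\<xi> c))) = prod_list (diag_mat (mat_diag d (\<lambda>j. \<sigma> j (\<xi> c))))"
    by (intro det_upper_triangular[where n = d]) (auto simp: mat_diag_def)
  also have "diag_mat (mat_diag d (\<lambda>j. \<sigma> j (\<xi> c))) = map (\<lambda>j. \<sigma> j (\<xi> c)) [0..<d]"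
    by (simp add: diag_mat_def mat_diag_def)
  also have "prod_list \<dots> = complex_of_real r"
    unfolding r(2)[symmetric] by (simp add: prod.distinct_set_conv_list[symmetric] atLeast0LessThan)
  finally have diag: "det (mat_diag d (\<lambda>j. \<sigma> j (\<xi> c))) = complex_of_real r" .
  have "det (map_mat of_int (C c) * basis_mat d \<sigma> (\<lambda>i. \<alpha> ^ (d - 1 - i))) =
      of_int (det (C c)) * det (basis_mat d \<sigma> (\<lambda>i. \<alpha> ^ (d - 1 - i)))"
    by (subst det_mult[where n = d]) (auto simp: of_int_hom.hom_det)
  moreover have "det (basis_mat d \<sigma> \<beta> * mat_diag d (\<lambda>j. \<sigma> j (\<xi> c))) =
      det (basis_mat d \<sigma> \<beta>) * complex_of_real r"
    by (subst det_mult[where n = d]) (auto simp: diag)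
  ultimately show ?thesis
    using sgn_pos_eq[OF _ r(1) orientation det_powers_nonzero] C_times_basis_mat by metis
qed

lemma xi_inj:
  assumes "\<xi> c = \<xi> c'" "c \<in> carrier_vec d" "c' \<in> carrier_vec d"
  shows "c = c'"
  using Z_basis_coeff_eq[OF basis_inv, of "\<lambda>i. c $ i" "\<lambda>i. c' $ i"] assms
  by (intro eq_vecI) (auto simp: xi_def)

text \<open>Without real embeddings \<open>K_pos\<close> contains 0, so total positivity alone does not suffice.\<close>

lemma xi_nonzero:
  assumes "\<xi> c \<in> K_pos \<alpha> r1 r2 \<sigma>" "bezout_vec d (C c) u"
  shows "\<xi> c \<noteq> 0"
proof
  assume zero: "\<xi> c = 0"
  \<comment> \<open>For \<open>d = 1\<close> the minor is the empty matrix with determinant 1, so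
    the Bezout condition would not exclude 0. There the only embedding is real, and positivity
    excludes it. For larger \<open>d\<close> all minors of the zero matrix vanish.\<close>
  have "d \<noteq> 1"
  proof
    assume "d = 1"
    then have "r1 = 1" using d_eq by presburger
    moreover have "\<forall>j<r1. Re (\<sigma> j (\<xi> c)) > 0" using assms(1) K_pos_iff by blast
    ultimately have "Re (\<sigma> 0 0) > 0" using zero by simp
    then show False using embedding_0[OF embedding[OF d_pos]] by simp
  qed
  have "c $ i = 0" if "i < d" for i
    using Z_basis_coeff_eq[OF basis_inv, of "\<lambda>i. c $ i" "\<lambda>i. 0"] zero that by (simp add: xi_def)
  then have "C c = 0\<^sub>m d d" by (auto simp: C_mat_def)
  then have "minor_det d (C c) j = det (0\<^sub>m (d - 1) (d - 1) :: int mat)" if "j < d" for j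
    unfolding minor_det_def using that d_pos
    by (intro arg_cong[where f = det] eq_matI) (auto simp: mat_delete_def)
  moreover have "det (0\<^sub>m (d - 1) (d - 1) :: int mat) = 0"
    using d_pos \<open>d \<noteq> 1\<close> by (intro det_zero) auto
  ultimately show False using assms(2) by (simp add: bezout_vec_def)
qed

text \<open>Both \<open>\<gamma>\<close> and its inverse are integral, so the scaled basis and the
  rows of the root matrix are integer combinations of each other.\<close>

lemma scaled_ideal_eq_root_lattice:
  assumes u: "bezout_vec d (C c) u" and eq: "gamma_inv d (C c) u * root_mat d m w = C c"
  shows "(\<lambda>x. \<xi> c * x) ` L = root_lattice d \<alpha> m w"
proof -
  let ?G = "gamma_inv d (C c) u" and ?rows = "rows_at d \<alpha> (root_mat d m w)"
  let ?p = "\<lambda>i. \<alpha> ^ (d - 1 - i)"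
  obtain \<gamma> where \<gamma>: "\<gamma> \<in> SL_int d" "?G * \<gamma> = 1\<^sub>m d" "\<gamma> * ?G = 1\<^sub>m d"
    using SL_int_inverse[OF bezout_imp_SL[OF d_pos C_mat_carrier u]] by metis
  then have \<gamma>c: "\<gamma> \<in> carrier_mat d d" by (simp add: SL_int_def)
  have "\<gamma> * C c = (\<gamma> * ?G) * root_mat d m w"
    unfolding assoc_mult_mat[OF \<gamma>c gamma_inv_carrier root_mat_carrier] eq ..
  then have root: "\<gamma> * C c = root_mat d m w" using \<gamma>(3) left_mult_one_mat[OF root_mat_carrier] by simp
  have rows: "?rows i = (\<Sum>j<d. of_int (root_mat d m w $$ (i, j)) * ?p j)" for i
    by (simp add: rows_at_def)
  have 1: "?rows i = (\<Sum>j<d. of_int (\<gamma> $$ (i, j)) * (\<xi> c * \<beta> j))" if "i < d" for i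
    using int_comb_mult[where b = ?p and b' = "\<lambda>j. \<xi> c * \<beta> j", OF \<gamma>c C_mat_carrier xi_mult_basis that]
      rows root by simp
  have 2: "\<xi> c * \<beta> i = (\<Sum>j<d. of_int (?G $$ (i, j)) * ?rows j)" if "i < d" for i
    using int_comb_mult[where b = ?p and b' = ?rows, OF gamma_inv_carrier root_mat_carrier rows that]
      xi_mult_basis[OF that] eq by simp
  have "(\<lambda>x. \<xi> c * x) ` L = range (\<lambda>z :: nat \<Rightarrow> int. \<Sum>i<d. of_int (z i) * (\<xi> c * \<beta> i))"
    unfolding Z_basis_range[OF basis] by (simp add: image_image sum_distrib_left mult.left_commute)
  also have "\<dots> = range (\<lambda>z :: nat \<Rightarrow> int. \<Sum>i<d. of_int (z i) * ?rows i)"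
    by (intro equalityI int_comb_subset) (erule 2, erule 1)
  finally show ?thesis using root_lattice_eq_range[OF d_pos] by simp
qed

text \<open>Modulo the ideal \<open>\<alpha>\<close> equals \<open>\<mu>\<close>, hence so do their
  polynomial values. The induction follows Horner: splitting off the constant coefficient leaves
  \<open>\<alpha>\<close> times the difference for \<open>p\<close> plus \<open>p(\<mu>)\<close>
  times \<open>\<alpha> - \<mu>\<close>.\<close>

lemma poly_diff_mem_scaled_ideal:
  assumes "\<alpha> - of_int \<mu> \<in> (\<lambda>x. \<xi> c * x) ` L"
  shows "poly (map_poly of_int p) \<alpha> - of_int (poly p \<mu>) \<in> (\<lambda>x. \<xi> c * x) ` L"
proof (induction p)
  case 0
  then show ?case using ideal_0 by (auto intro: image_eqI[where x = 0])
next
  case (pCons a p)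
  obtain x where x: "x \<in> L" "\<alpha> - of_int \<mu> = \<xi> c * x" using assms by blast
  obtain y where y: "y \<in> L" "poly (map_poly of_int p) \<alpha> - of_int (poly p \<mu>) = \<xi> c * y"
    using pCons.IH by blast
  have "poly (map_poly of_int (pCons a p)) \<alpha> - of_int (poly (pCons a p) \<mu>) =
      \<alpha> * (poly (map_poly of_int p) \<alpha> - of_int (poly p \<mu>)) + of_int (poly p \<mu>) * (\<alpha> - of_int \<mu>)"
    by (simp add: map_poly_pCons algebra_simps)
  also have "\<dots> = \<xi> c * (\<alpha> * y + of_int (poly p \<mu>) * x)"
    unfolding x(2) y(2) by (simp add: algebra_simps)
  finally show ?case using x(1) y(1) by (auto intro!: ideal_add ideal_mult_Z_adj)
qed

text \<open>For \<open>d \<ge> 2\<close> row \<open>d - 2\<close> has this form with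
  \<open>\<mu> = w $ (d - 2)\<close>. For \<open>d = 1\<close> there is no such row, but
  \<open>\<alpha>\<close> itself is an integer and the difference is 0.\<close>

lemma exists_linear_mem_root_lattice: "\<exists>\<mu>. \<alpha> - of_int \<mu> \<in> root_lattice d \<alpha> m w"
proof (cases "d = 1")
  case True
  have "\<alpha> \<in> range (\<lambda>z :: nat \<Rightarrow> int. \<Sum>i<d. of_int (z i) * \<alpha> ^ (d - 1 - i))"
    using Z_adj_gen Z_basis_range[OF powers] by blast
  then obtain \<mu> :: int where "\<alpha> = of_int \<mu>" using True by auto
  then show ?thesis using of_int_mem_root_lattice[of 0 m w] by (intro exI[of _ \<mu>]) simp
next
  case False
  then have "d - 2 < d - 1" "d - 1 - (d - 2) = 1" using d_pos by auto
  then show ?thesis using power_diff_mem_root_lattice[of "d - 2" w m] by auto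
qed

lemma factorization_imp_root:
  assumes F: "poly (map_poly of_int F) \<alpha> = 0"
    and u: "bezout_vec d (C c) u" and eq: "gamma_inv d (C c) u * root_mat d m w = C c"
    and w: "w \<in> carrier_vec (d - 1)"
  shows "\<exists>\<mu>. [poly F \<mu> = 0] (mod m) \<and> power_reps d m \<mu> w"
proof -
  let ?J = "root_lattice d \<alpha> m w"
  note J = scaled_ideal_eq_root_lattice[OF u eq]
  \<comment> \<open>Closure of the lattice under negation and addition is borrowed from the ideal
    \<open>L\<close> that it rescales.\<close>
  have minus: "- x \<in> ?J" if x: "x \<in> ?J" for x
  proof -
    obtain y where "y \<in> L" "x = \<xi> c * y" using x J by blast
    then have "- x = \<xi> c * (of_int (-1) * y)" "of_int (-1) * y \<in> L"
      using ideal_mult_Z_adj[OF Z_adj_of_int, of y "-1"] by simp_all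
    then show ?thesis using J by blast
  qed
  have add: "x + y \<in> ?J" if xy: "x \<in> ?J" "y \<in> ?J" for x y
  proof -
    obtain s t where "s \<in> L" "t \<in> L" "x = \<xi> c * s" "y = \<xi> c * t" using xy J by blast
    then have "x + y = \<xi> c * (s + t)" "s + t \<in> L" by (auto simp: distrib_left ideal_add)
    then show ?thesis using J by blast
  qed
  obtain \<mu> where \<mu>: "\<alpha> - of_int \<mu> \<in> ?J" using exists_linear_mem_root_lattice by blast
  have poly_diff: "poly (map_poly of_int p) \<alpha> - of_int (poly p \<mu>) \<in> ?J" for p
    using poly_diff_mem_scaled_ideal[of \<mu> c p] \<mu> unfolding J by blast
  \<comment> \<open>Since \<open>F\<close> vanishes at \<open>\<alpha>\<close>, the difference for
    \<open>F\<close> is the integer \<open>- F(\<mu>)\<close>, and the integers in the lattice are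
    the multiples of \<open>m\<close>.\<close>
  have "of_int (poly F \<mu>) \<in> ?J" using minus[OF poly_diff[of F]] F by simp
  then have "[poly F \<mu> = 0] (mod m)" by (simp add: of_int_mem_root_lattice cong_0_iff)
  moreover have "[w $ i = \<mu> ^ (d - 1 - i)] (mod m)" if "i < d - 1" for i
  proof -
    \<comment> \<open>The same power of \<open>\<alpha>\<close> is congruent to
      \<open>\<mu> ^ (d - 1 - i)\<close> and to \<open>w $ i\<close>; subtracting leaves an integer
      in the lattice.\<close>
    have "(\<alpha> ^ (d - 1 - i) - of_int (\<mu> ^ (d - 1 - i))) + - (\<alpha> ^ (d - 1 - i) - of_int (w $ i)) \<in> ?J"
      using poly_diff[of "monom 1 (d - 1 - i)"] minus[OF power_diff_mem_root_lattice[OF that]]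
      by (intro add) (simp_all add: map_poly_monom poly_monom)
    moreover have "(\<alpha> ^ (d - 1 - i) - of_int (\<mu> ^ (d - 1 - i))) + - (\<alpha> ^ (d - 1 - i) - of_int (w $ i)) =
        of_int (w $ i - \<mu> ^ (d - 1 - i))" by simp
    ultimately have "m dvd w $ i - \<mu> ^ (d - 1 - i)" by (simp only: of_int_mem_root_lattice)
    then show ?thesis by (simp add: cong_iff_dvd_diff)
  qed
  ultimately show ?thesis using w by (auto simp: power_reps_def)
qed

section \<open>Bezout vectors and representatives of the residues\<close>

lemma exists_factorization:
  assumes u: "bezout_vec d (C c) u"
  shows "\<exists>w. w \<in> carrier_vec (d - 1) \<and> gamma_inv d (C c) u * root_mat d (det (C c)) w = C c"
proof -
  let ?G = "gamma_inv d (C c) u"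
  obtain \<gamma> where \<gamma>: "\<gamma> \<in> SL_int d" "?G * \<gamma> = 1\<^sub>m d" "\<gamma> * ?G = 1\<^sub>m d"
    using SL_int_inverse[OF bezout_imp_SL[OF d_pos C_mat_carrier u]] by metis
  then have \<gamma>c: "\<gamma> \<in> carrier_mat d d" "det \<gamma> = 1" by (auto simp: SL_int_def)
  define M where "M = \<gamma> * C c"
  define w where "w = vec (d - 1) (\<lambda>i. - M $$ (i, d - 1))"
  have Mc: "M \<in> carrier_mat d d" using \<gamma>c by (auto simp: M_def)
  \<comment> \<open>\<open>C\<close> and \<open>?G\<close> share their first \<open>d - 1\<close>
    columns, so \<open>\<gamma> * C\<close> and \<open>\<gamma> * ?G\<close>, the identity, share
    them too. Hence \<open>M\<close> has the shape of a root matrix, with \<open>w\<close> the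
    negated last column.\<close>
  have first: "M $$ (i, j) = 1\<^sub>m d $$ (i, j)" if "i < d" "j < d - 1" for i j
  proof -
    have "M $$ (i, j) = (\<Sum>k<d. \<gamma> $$ (i, k) * C c $$ (k, j))"
      unfolding M_def using that by (intro mat_mult_entry[OF \<gamma>c(1) C_mat_carrier]) auto
    also have "\<dots> = (\<Sum>k<d. \<gamma> $$ (i, k) * ?G $$ (k, j))"
      using that by (intro sum.cong) (auto simp: gamma_inv_def)
    also have "\<dots> = (\<gamma> * ?G) $$ (i, j)"
      using that by (intro mat_mult_entry[OF \<gamma>c(1) gamma_inv_carrier, symmetric]) auto
    finally show ?thesis using \<gamma>(3) by simp
  qed
  have M: "M = root_mat d (M $$ (d - 1, d - 1)) w"
  proof (rule eq_matI)
    fix i j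
    assume "i < dim_row (root_mat d (M $$ (d - 1, d - 1)) w)" "j < dim_col (root_mat d (M $$ (d - 1, d - 1)) w)"
    then have ij: "i < d" "j < d" by (auto simp: root_mat_def)
    show "M $$ (i, j) = root_mat d (M $$ (d - 1, d - 1)) w $$ (i, j)"
    proof (cases "j < d - 1")
      case True
      then show ?thesis using ij first[of i j] by (simp add: root_mat_def)
    next
      case False
      then have "j = d - 1" using ij by simp
      moreover have "i = d - 1" if "\<not> i < d - 1" using that ij by simp
      ultimately show ?thesis using ij by (auto simp: root_mat_def w_def)
    qed
  qed (use Mc in \<open>auto simp: root_mat_def\<close>)
  have "det M = det (C c)" using det_mult[OF \<gamma>c(1) C_mat_carrier] \<gamma>c(2) by (simp add: M_def)
  then have "M $$ (d - 1, d - 1) = det (C c)" using M det_root_mat[OF d_pos] by metis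
  moreover have "?G * M = C c"
    unfolding M_def using \<gamma>(2) left_mult_one_mat[OF C_mat_carrier]
    by (simp add: assoc_mult_mat[OF gamma_inv_carrier \<gamma>c(1) C_mat_carrier, symmetric])
  ultimately show ?thesis using M by (intro exI[of _ w]) (auto simp: w_def)
qed

text \<open>Compare determinants: the Bezout factor has determinant 1 and the root matrix has
  determinant \<open>m\<close>. So \<open>m\<close> does not depend on \<open>u\<close>.\<close>

lemma factorization_modulus:
  assumes "bezout_vec d (C c) u" "gamma_inv d (C c) u * root_mat d m w = C c"
  shows "m = det (C c)"
  using det_of_factorization[OF d_pos C_mat_carrier assms(2)] bezout_imp_SL[OF d_pos C_mat_carrier assms(1)]
  by (simp add: SL_int_def)

lemma factorization_unique:
  assumes u: "bezout_vec d (C c) u"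
    and "gamma_inv d (C c) u * root_mat d m w = C c" "gamma_inv d (C c) u * root_mat d m w' = C c"
    and "w \<in> carrier_vec (d - 1)" "w' \<in> carrier_vec (d - 1)"
  shows "w = w'"
proof -
  let ?G = "gamma_inv d (C c) u"
  obtain \<gamma> where \<gamma>: "\<gamma> \<in> SL_int d" "\<gamma> * ?G = 1\<^sub>m d"
    using SL_int_inverse[OF bezout_imp_SL[OF d_pos C_mat_carrier u]] by metis
  then have \<gamma>c: "\<gamma> \<in> carrier_mat d d" by (simp add: SL_int_def)
  have "(\<gamma> * ?G) * root_mat d m w = (\<gamma> * ?G) * root_mat d m w'"
    unfolding assoc_mult_mat[OF \<gamma>c gamma_inv_carrier root_mat_carrier] assms(2,3) ..
  then have "root_mat d m w = root_mat d m w'"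
    unfolding \<gamma>(2) left_mult_one_mat[OF root_mat_carrier] .
  then show ?thesis using root_mat_inj assms(4,5) by blast
qed

text \<open>Both Bezout vectors describe the same ideal, hence the same lattice. It contains each
  power shifted by \<open>w $ i\<close> and by \<open>w0 $ i\<close>; the difference is an integer
  and so divisible by \<open>m\<close>, and the residues are unchanged.\<close>

lemma reps_of_bezout:
  assumes u0: "bezout_vec d (C c) u0" "gamma_inv d (C c) u0 * root_mat d m w0 = C c" "power_reps d m \<mu> w0"
    and u: "bezout_vec d (C c) u"
  shows "\<exists>!w. power_reps d m \<mu> w \<and> gamma_inv d (C c) u * root_mat d m w = C c"
proof -
  obtain w where w: "w \<in> carrier_vec (d - 1)" "gamma_inv d (C c) u * root_mat d m w = C c"
    using exists_factorization[OF u] factorization_modulus[OF u0(1,2)] by auto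
  have J: "root_lattice d \<alpha> m w = root_lattice d \<alpha> m w0"
    using scaled_ideal_eq_root_lattice u u0 w(2) by metis
  have "[w $ i = \<mu> ^ (d - 1 - i)] (mod m)" if i: "i < d - 1" for i
  proof -
    have "\<alpha> ^ (d - 1 - i) - of_int (w $ i) \<in> (\<lambda>x. \<xi> c * x) ` L"
      "\<alpha> ^ (d - 1 - i) - of_int (w0 $ i) \<in> (\<lambda>x. \<xi> c * x) ` L"
      using power_diff_mem_root_lattice[OF i] J scaled_ideal_eq_root_lattice[OF u0(1,2)] by auto
    then obtain x y where xy: "x \<in> L" "y \<in> L" "\<alpha> ^ (d - 1 - i) - of_int (w $ i) = \<xi> c * x"
      "\<alpha> ^ (d - 1 - i) - of_int (w0 $ i) = \<xi> c * y" by blast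
    have "of_int (w $ i - w0 $ i) = (\<alpha> ^ (d - 1 - i) - of_int (w0 $ i)) - (\<alpha> ^ (d - 1 - i) - of_int (w $ i))"
      by simp
    also have "\<dots> = \<xi> c * (y + of_int (-1) * x)"
      unfolding xy(3,4) by (simp add: algebra_simps)
    finally have "of_int (w $ i - w0 $ i) \<in> root_lattice d \<alpha> m w0"
      using xy(1,2) ideal_add ideal_mult_Z_adj[OF Z_adj_of_int]
      unfolding scaled_ideal_eq_root_lattice[OF u0(1,2), symmetric] by blast
    then have "[w $ i = w0 $ i] (mod m)" by (simp only: of_int_mem_root_lattice cong_iff_dvd_diff)
    then show ?thesis using u0(3) i cong_trans unfolding power_reps_def by blast
  qed
  then have "power_reps d m \<mu> w" using w(1) by (simp add: power_reps_def)
  then show ?thesis using w(2) factorization_unique[OF u] by (auto simp: power_reps_def)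
qed

lemma bezout_of_reps:
  assumes "m > 0"
    and u0: "bezout_vec d (C c) u0" "gamma_inv d (C c) u0 * root_mat d m w0 = C c" "power_reps d m \<mu> w0"
    and w: "power_reps d m \<mu> w"
  shows "\<exists>!u. bezout_vec d (C c) u \<and> gamma_inv d (C c) u * root_mat d m w = C c"
proof -
  note factor_iff = gamma_inv_times_root_mat_eq_iff[OF d_pos C_mat_carrier]
  have cong: "m dvd w $ k - w0 $ k" if "k < d - 1" for k
    using u0(3) w that cong_trans cong_sym unfolding power_reps_def cong_iff_dvd_diff[symmetric] by blast
  \<comment> \<open>This solves the last column for \<open>u\<close>. The division is exact: the
    numerator is \<open>m * u0 $ i\<close> plus a combination of the differences
    \<open>w $ k - w0 $ k\<close>, all multiples of \<open>m\<close>.\<close>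
  define u where "u = vec d (\<lambda>i. (C c $$ (i, d - 1) + (\<Sum>k<d - 1. C c $$ (i, k) * w $ k)) div m)"
  have "C c $$ (i, d - 1) = m * u $ i - (\<Sum>k<d - 1. C c $$ (i, k) * w $ k)" if "i < d" for i
  proof -
    have "C c $$ (i, d - 1) + (\<Sum>k<d - 1. C c $$ (i, k) * w $ k) =
        m * u0 $ i + (\<Sum>k<d - 1. C c $$ (i, k) * (w $ k - w0 $ k))"
      using u0(2) that unfolding factor_iff by (simp add: right_diff_distrib sum_subtractf)
    also have "m dvd \<dots>" using cong by (intro dvd_add[OF dvd_triv_left] dvd_sum dvd_mult) simp
    finally have "m dvd C c $$ (i, d - 1) + (\<Sum>k<d - 1. C c $$ (i, k) * w $ k)" .
    then show ?thesis using that by (simp add: u_def)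
  qed
  then have eq: "gamma_inv d (C c) u * root_mat d m w = C c" unfolding factor_iff by blast
  \<comment> \<open>The Bezout condition comes for free: both factorizations have determinant
    \<open>det C = m\<close>, and \<open>m\<close> is nonzero.\<close>
  then have "m = det (gamma_inv d (C c) u) * m"
    using det_of_factorization[OF d_pos C_mat_carrier] factorization_modulus[OF u0(1,2)] by metis
  then have "bezout_vec d (C c) u"
    using \<open>m > 0\<close> bezout_iff_det[OF d_pos C_mat_carrier, of u] by (simp add: u_def)
  moreover have "v = v'" if "bezout_vec d (C c) v" "gamma_inv d (C c) v * root_mat d m w = C c"
    "bezout_vec d (C c) v'" "gamma_inv d (C c) v' * root_mat d m w = C c" for v v'
  proof (rule eq_vecI)
    fix i assume "i < dim_vec v'"
    then have "i < d" using that(3) by (auto simp: bezout_vec_def)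
    then have "m * v $ i = m * v' $ i" using that(2,4) unfolding factor_iff by simp
    then show "v $ i = v' $ i" using \<open>m > 0\<close> by simp
  qed (use that in \<open>auto simp: bezout_vec_def\<close>)
  ultimately show ?thesis using eq by blast
qed

text \<open>The rows generate a subset of the order, so \<open>y\<close> multiplies \<open>L\<close>
  into the order and lies in the inverse ideal; its coordinates there are \<open>c\<close>. The
  vector \<open>u\<close> is the last column of the inverse change of basis.\<close>

lemma exists_coordinates:
  assumes y: "y \<in> K_pos \<alpha> r1 r2 \<sigma>" "y \<noteq> 0" and m: "m > 0"
    and J: "Z_basis d (rows_at d \<alpha> (root_mat d m w)) ((\<lambda>x. y * x) ` L)"
  shows "\<exists>c u. c \<in> carrier_vec d \<and> \<xi> c = y \<and> bezout_vec d (C c) u \<and>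
    gamma_inv d (C c) u * root_mat d m w = C c"
proof -
  let ?p = "\<lambda>i. \<alpha> ^ (d - 1 - i)"
  have "rows_at d \<alpha> (root_mat d m w) i \<in> Z_adj \<alpha>" for i
    unfolding rows_at_def by (intro Z_adj_sum Z_adj_mult Z_adj_power) auto
  then have "(\<lambda>x. y * x) ` L \<subseteq> Z_adj \<alpha>"
    unfolding Z_basis_range[OF J] by (auto intro!: Z_adj_sum Z_adj_mult)
  then have "y \<in> ideal_inv \<alpha> L" using K_pos_imp_Q_adj[OF y(1)] by (auto simp: ideal_inv_def)
  then obtain z :: "nat \<Rightarrow> int" where z: "y = (\<Sum>i<d. of_int (z i) * \<beta>' i)"
    unfolding Z_basis_range[OF basis_inv] by blast
  define c where "c = vec d z"
  have c: "\<xi> c = y" unfolding z xi_def c_def by (intro sum.cong) auto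
  obtain A B where AB: "A \<in> carrier_mat d d" "B \<in> carrier_mat d d" "A * B = 1\<^sub>m d" "B * A = 1\<^sub>m d"
    and rows: "\<And>i. i < d \<Longrightarrow> rows_at d \<alpha> (root_mat d m w) i = (\<Sum>j<d. of_int (A $$ (i, j)) * (y * \<beta> j))"
    by (rule Z_basis_change[OF Z_basis_scale[OF basis y(2)] J]) blast
  have root: "root_mat d m w = A * C c"
  proof (rule Z_basis_mat_eq[OF powers root_mat_carrier])
    fix i assume i: "i < d"
    show "(\<Sum>j<d. of_int (root_mat d m w $$ (i, j)) * ?p j) = (\<Sum>j<d. of_int ((A * C c) $$ (i, j)) * ?p j)"
      using int_comb_mult[where b = ?p and b' = "\<lambda>j. \<xi> c * \<beta> j", OF AB(1) C_mat_carrier xi_mult_basis i]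
        rows[OF i] c by (simp add: rows_at_def)
  qed (use AB in auto)
  \<comment> \<open>A unimodular \<open>A\<close> has determinant 1 or -1; positivity of
    \<open>m\<close> and of \<open>det (C c)\<close> selects 1.\<close>
  have "det A * det (C c) = m"
    using det_mult[OF AB(1) C_mat_carrier[of d b c]] root det_root_mat[OF d_pos] by metis
  moreover have "det A * det B = 1" using det_mult[OF AB(1,2)] AB(3) by simp
  moreover have "det (C c) > 0" using det_C_pos y c by simp
  ultimately have "det B = 1" using m
    by (metis mult.commute pos_zmult_eq_1_iff zero_less_mult_pos2)
  define u where "u = vec d (\<lambda>i. B $$ (i, d - 1))"
  have BC: "B * root_mat d m w = C c"
    unfolding root assoc_mult_mat[OF AB(2,1) C_mat_carrier, symmetric] AB(4)
    by (rule left_mult_one_mat[OF C_mat_carrier])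
  have "gamma_inv d (C c) u = B"
  proof (rule eq_matI)
    fix i j assume "i < dim_row B" "j < dim_col B"
    then have ij: "i < d" "j < d" using AB by auto
    show "gamma_inv d (C c) u $$ (i, j) = B $$ (i, j)"
    proof (cases "j < d - 1")
      case True
      \<comment> \<open>The unit columns of the root matrix make \<open>B\<close> share its first
        \<open>d - 1\<close> columns with \<open>C\<close>, as \<open>gamma_inv\<close>
        requires.\<close>
      have "C c $$ (i, j) = (\<Sum>k<d. B $$ (i, k) * root_mat d m w $$ (k, j))"
        using mat_mult_entry[OF AB(2) root_mat_carrier ij] BC by metis
      also have "\<dots> = (\<Sum>k<d. if k = j then B $$ (i, k) else 0)"
        using True by (intro sum.cong) (auto simp: root_mat_def)
      finally show ?thesis using ij True by (simp add: gamma_inv_def)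
    next
      case False
      then have "j = d - 1" using ij by simp
      then show ?thesis using ij by (simp add: gamma_inv_def u_def)
    qed
  qed (use AB in \<open>auto simp: gamma_inv_def\<close>)
  then have "bezout_vec d (C c) u" "gamma_inv d (C c) u * root_mat d m w = C c"
    using bezout_iff_det[OF d_pos C_mat_carrier] \<open>det B = 1\<close> BC by (auto simp: u_def)
  then show ?thesis using c by (intro exI[of _ c] exI[of _ u]) (simp add: c_def)
qed

lemma gamma_equations_iff_factorization:
  assumes "bezout_vec d (C c) u"
  shows "gamma_equations d \<sigma> (basis_mat d \<sigma> (\<lambda>i. \<alpha> ^ (d - 1 - i))) (basis_mat d \<sigma> \<beta>) (C c) (\<xi> c) u m w
    \<longleftrightarrow> gamma_inv d (C c) u * root_mat d m w = C c"
  by (intro gamma_equations_iff d_pos C_mat_carrier basis_mat_carrier C_times_basis_mat assms)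

section \<open>Units and the fundamental domain\<close>

lemma scaled_ideal_unit:
  assumes "e \<in> Z_adj \<alpha>" "e' \<in> Z_adj \<alpha>" "e * e' = 1"
  shows "(\<lambda>t. (e * x) * t) ` L = (\<lambda>t. x * t) ` L"
proof (intro equalityI image_subsetI)
  fix t assume t: "t \<in> L"
  have "e * x * t = x * (e * t)" by (simp add: ac_simps)
  then show "e * x * t \<in> (\<lambda>t. x * t) ` L"
    using ideal_mult_Z_adj[OF assms(1) t] by blast
  have "x * t = x * t * (e * e')" using assms(3) by simp
  also have "\<dots> = e * x * (e' * t)" by (simp add: ac_simps)
  finally show "x * t \<in> (\<lambda>t. (e * x) * t) ` L"
    using ideal_mult_Z_adj[OF assms(2) t] by blast
qed

text \<open>Each of \<open>y * inverse x\<close> and \<open>x * inverse y\<close> maps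
  \<open>L\<close> into itself, so both lie in the order and are inverse to each other.\<close>

lemma scaled_ideal_eq_imp_unit:
  assumes x: "x \<in> K_pos \<alpha> r1 r2 \<sigma>" "x \<noteq> 0" and y: "y \<in> K_pos \<alpha> r1 r2 \<sigma>" "y \<noteq> 0"
    and eq: "(\<lambda>t. x * t) ` L = (\<lambda>t. y * t) ` L"
  shows "y * inverse x \<in> pos_units \<alpha> r1 r2 \<sigma>"
proof -
  have mult: "v * inverse u \<in> Z_adj \<alpha>" if "(\<lambda>t. u * t) ` L = (\<lambda>t. v * t) ` L" "u \<noteq> 0" for u v
  proof (rule invertible_ideal_multiplier[OF invertible])
    fix t assume "t \<in> L"
    then have "v * t \<in> (\<lambda>t. u * t) ` L" unfolding that(1) by (rule imageI)
    then obtain s where "v * t = u * s" "s \<in> L" by (rule imageE)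
    then have "v * inverse u * t = inverse u * (u * s)" by (metis mult.commute mult.left_commute)
    also have "\<dots> = s" using that(2) by (simp flip: mult.assoc)
    finally show "v * inverse u * t \<in> L" using \<open>s \<in> L\<close> by simp
  qed
  have "y * inverse x * (x * inverse y) = 1" using x(2) y(2) by (simp add: field_simps)
  moreover have "y * inverse x \<in> K_pos \<alpha> r1 r2 \<sigma>" by (intro K_pos_mult K_pos_inverse x(1) y(1))
  ultimately show ?thesis
    unfolding pos_units_def using mult[OF eq x(2)] mult[OF eq[symmetric] y(2)]
    by (intro CollectI IntI conjI bexI[where x = "x * inverse y"])
qed

lemma scaled_ideal_inj:
  assumes D: "fundamental_domain \<alpha> r1 r2 \<sigma> D"
    and x: "x \<in> D" "x \<noteq> 0" and y: "y \<in> D" "y \<noteq> 0"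
    and eq: "(\<lambda>t. x * t) ` L = (\<lambda>t. y * t) ` L"
  shows "x = y"
proof -
  have K: "x \<in> K_pos \<alpha> r1 r2 \<sigma>" "y \<in> K_pos \<alpha> r1 r2 \<sigma>"
    using D x y by (auto simp: fundamental_domain_def)
  have "\<exists>!z. z \<in> D \<and> (\<exists>e \<in> pos_units \<alpha> r1 r2 \<sigma>. z = e * x)"
    using D K(1) x(2) by (simp add: fundamental_domain_def)
  \<comment> \<open>With this spelling the unit lemma for the pair \<open>x\<close>,
    \<open>x\<close> places \<open>x\<close> in its own orbit, next to \<open>y\<close>.\<close>
  moreover have "x = x * inverse x * x" "y = y * inverse x * x" using x(2) by simp_all
  ultimately show ?thesis
    using scaled_ideal_eq_imp_unit[OF K(1) x(2) K(2) y(2) eq]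
      scaled_ideal_eq_imp_unit[OF K(1) x(2) K(1) x(2) refl] x(1) y(1) by metis
qed

end

section \<open>The correspondence between coordinates and roots modulo \<open>m\<close>\<close>

lemma ex1_pairI:
  assumes "P a b" and "\<And>x y. P x y \<Longrightarrow> x = a \<and> y = b"
  shows "\<exists>!(x, y). P x y"
proof (rule ex1I)
  show "case (a, b) of (x, y) \<Rightarrow> P x y" using assms(1) by simp
  fix p assume "case p of (x, y) \<Rightarrow> P x y"
  then have "P (fst p) (snd p)" by (simp only: case_prod_beta)
  from assms(2)[OF this] show "p = (a, b)" by (metis prod.collapse)
qed

theorem theorem4:
  fixes F :: "int poly" and \<alpha> :: complex and d r1 r2 h :: nat
    and \<sigma> :: "nat \<Rightarrow> complex \<Rightarrow> complex"
    and I :: "nat \<Rightarrow> complex set"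
    and \<beta> \<beta>' :: "nat \<Rightarrow> nat \<Rightarrow> complex"
    and b :: "nat \<Rightarrow> nat \<Rightarrow> nat \<Rightarrow> nat \<Rightarrow> int"
    and D :: "complex set"
  defines "d \<equiv> degree F"
    and "h \<equiv> narrow_class_number \<alpha> r1 r2 \<sigma>"
  assumes monic: "lead_coeff F = 1" and irred: "irreducible F"
    and root: "poly (map_poly of_int F) \<alpha> = 0"
    and embeddings: "embedding_list \<alpha> d r1 r2 \<sigma>"
    and reps: "narrow_representatives \<alpha> r1 r2 \<sigma> I"
    and basis: "\<forall>l \<in> {1..h}. Z_basis d (\<beta> l) (I l)"
    and basis_1: "\<forall>i < d. \<beta> 1 i = \<alpha> ^ (d - 1 - i)"
    and orientation: "\<forall>l \<in> {1..h}.
      sgn (det (basis_mat d \<sigma> (\<beta> l))) = sgn (det (basis_mat d \<sigma> (\<beta> 1)))"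
    and basis_inv: "\<forall>l \<in> {1..h}. Z_basis d (\<beta>' l) (ideal_inv \<alpha> (I l))"
    and structure_constants: "\<forall>l \<in> {1..h}. \<forall>i < d. \<forall>j < d.
      \<beta>' l i * \<beta> l j = (\<Sum>k<d. of_int (b l i j k) * \<alpha> ^ (d - 1 - k))"
    and domain: "fundamental_domain \<alpha> r1 r2 \<sigma> D"
  shows "(\<forall>l \<in> {1..h}. \<forall>c. admissible d (\<beta>' l) (b l) D c \<longrightarrow>
            (\<exists>u. bezout_vec d (C_mat d (b l) c) u) \<and>
            (\<forall>u. bezout_vec d (C_mat d (b l) c) u \<longrightarrow>
               gamma_inv d (C_mat d (b l) c) u \<in> SL_int d \<and>
               (\<exists>m \<mu> w. m > 0 \<and> [poly F \<mu> = 0] (mod m) \<and> power_reps d m \<mu> w \<and>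
                  gamma_equations d \<sigma> (basis_mat d \<sigma> (\<beta> 1)) (basis_mat d \<sigma> (\<beta> l))
                    (C_mat d (b l) c) (xi d (\<beta>' l) c) u m w)))
       \<and> (\<forall>m \<mu> J. m > 0 \<and> [poly F \<mu> = 0] (mod m) \<and>
            Z_basis d (rows_at d \<alpha> (root_mat d m (vec (d - 1) (\<lambda>i. \<mu> ^ (d - 1 - i))))) J \<and>
            invertible_ideal \<alpha> J \<longrightarrow>
            (\<exists>!(l, c). l \<in> {1..h} \<and> admissible d (\<beta>' l) (b l) D c \<and>
               (\<exists>u w. bezout_vec d (C_mat d (b l) c) u \<and> power_reps d m \<mu> w \<and>
                  gamma_equations d \<sigma> (basis_mat d \<sigma> (\<beta> 1)) (basis_mat d \<sigma> (\<beta> l))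
                    (C_mat d (b l) c) (xi d (\<beta>' l) c) u m w)) \<and>
            (\<forall>l \<in> {1..h}. \<forall>c. admissible d (\<beta>' l) (b l) D c \<and>
               (\<exists>u w. bezout_vec d (C_mat d (b l) c) u \<and> power_reps d m \<mu> w \<and>
                  gamma_equations d \<sigma> (basis_mat d \<sigma> (\<beta> 1)) (basis_mat d \<sigma> (\<beta> l))
                    (C_mat d (b l) c) (xi d (\<beta>' l) c) u m w) \<longrightarrow>
               (\<forall>u. bezout_vec d (C_mat d (b l) c) u \<longrightarrow>
                  (\<exists>!w. power_reps d m \<mu> w \<and>
                     gamma_equations d \<sigma> (basis_mat d \<sigma> (\<beta> 1)) (basis_mat d \<sigma> (\<beta> l))
                       (C_mat d (b l) c) (xi d (\<beta>' l) c) u m w)) \<and>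
               (\<forall>w. power_reps d m \<mu> w \<longrightarrow>
                  (\<exists>!u. bezout_vec d (C_mat d (b l) c) u \<and>
                     gamma_equations d \<sigma> (basis_mat d \<sigma> (\<beta> 1)) (basis_mat d \<sigma> (\<beta> l))
                       (C_mat d (b l) c) (xi d (\<beta>' l) c) u m w))))"
proof -
  let ?rel = "narrow_rel \<alpha> r1 r2 \<sigma>"
  let ?P = "\<lambda>l c m \<mu>. l \<in> {1..h} \<and> admissible d (\<beta>' l) (b l) D c \<and>
    (\<exists>u w. bezout_vec d (C_mat d (b l) c) u \<and> power_reps d m \<mu> w \<and>
      gamma_equations d \<sigma> (basis_mat d \<sigma> (\<beta> 1)) (basis_mat d \<sigma> (\<beta> l))
        (C_mat d (b l) c) (xi d (\<beta>' l) c) u m w)"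
  have d_pos: "0 < d"
  proof (rule ccontr)
    assume "\<not> 0 < d"
    then have "degree F = 0" by (simp add: d_def)
    then obtain a where "F = [:a:]" by (rule degree_eq_zeroE)
    then have "F = 1" using monic by (simp add: one_pCons)
    then show False using irred by (simp add: irreducible_def)
  qed
  have I: "invertible_ideal \<alpha> (I l)" if "l \<in> {1..h}" for l
    using reps that by (simp add: narrow_representatives_def h_def)
  have bij: "bij_betw (\<lambda>l. ?rel `` {I l}) {1..h} (narrow_classes \<alpha> r1 r2 \<sigma>)"
    and I1: "I 1 = Z_adj \<alpha>"
    using reps by (simp_all add: narrow_representatives_def h_def)
  have \<beta>1: "basis_mat d \<sigma> (\<beta> 1) = basis_mat d \<sigma> (\<lambda>i. \<alpha> ^ (d - 1 - i))"
    unfolding basis_mat_def using basis_1 by (intro cong_mat) auto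
  \<comment> \<open>Index 1 is in range once some \<open>l\<close> is; the power basis is then the
    given basis of \<open>I 1\<close>.\<close>
  have order: "embedded_order \<alpha> d r1 r2 \<sigma>" if "l \<in> {1..h}" for l
  proof
    have "1 \<in> {1..h}" using that by simp
    then have "Z_basis d (\<beta> 1) (Z_adj \<alpha>)" using basis I1 by metis
    moreover have "(\<Sum>i<d. of_int (z i) * \<beta> 1 i) = (\<Sum>i<d. of_int (z i) * \<alpha> ^ (d - 1 - i))"
      for z :: "nat \<Rightarrow> int" using basis_1 by (intro sum.cong) auto
    ultimately show "Z_basis d (\<lambda>i. \<alpha> ^ (d - 1 - i)) (Z_adj \<alpha>)" unfolding Z_basis_def by simp
  qed (use d_pos embeddings in auto)
  have ideal: "order_ideal \<alpha> d r1 r2 \<sigma> (I l) (\<beta> l) (\<beta>' l) (b l)" if "l \<in> {1..h}" for l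
    using order[OF that] I[OF that] that basis orientation basis_inv structure_constants
    unfolding order_ideal_def order_ideal_axioms_def \<beta>1 by blast
  have D: "x \<in> K_pos \<alpha> r1 r2 \<sigma>" if "x \<in> D" for x
    using domain that by (auto simp: fundamental_domain_def)
  have eqs: "gamma_equations d \<sigma> (basis_mat d \<sigma> (\<beta> 1)) (basis_mat d \<sigma> (\<beta> l))
        (C_mat d (b l) c) (xi d (\<beta>' l) c) u m w \<longleftrightarrow>
      gamma_inv d (C_mat d (b l) c) u * root_mat d m w = C_mat d (b l) c"
    if "l \<in> {1..h}" "bezout_vec d (C_mat d (b l) c) u" for l c u m w
    unfolding \<beta>1 by (rule order_ideal.gamma_equations_iff_factorization[OF ideal[OF that(1)] that(2)])

  have forward: "(\<exists>u. bezout_vec d (C_mat d (b l) c) u) \<and>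
      (\<forall>u. bezout_vec d (C_mat d (b l) c) u \<longrightarrow>
        gamma_inv d (C_mat d (b l) c) u \<in> SL_int d \<and>
        (\<exists>m \<mu> w. m > 0 \<and> [poly F \<mu> = 0] (mod m) \<and> power_reps d m \<mu> w \<and>
          gamma_equations d \<sigma> (basis_mat d \<sigma> (\<beta> 1)) (basis_mat d \<sigma> (\<beta> l))
            (C_mat d (b l) c) (xi d (\<beta>' l) c) u m w))"
    if l: "l \<in> {1..h}" and c: "admissible d (\<beta>' l) (b l) D c" for l c
  proof (intro conjI allI impI)
    interpret order_ideal \<alpha> d r1 r2 \<sigma> "I l" "\<beta> l" "\<beta>' l" "b l" by (rule ideal[OF l])
    show "\<exists>u. bezout_vec d (C c) u" using c Gcd_imp_bezout by (simp add: admissible_def)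
    fix u assume u: "bezout_vec d (C c) u"
    show "gamma_inv d (C c) u \<in> SL_int d" by (rule bezout_imp_SL[OF d_pos C_mat_carrier u])
    have \<xi>: "\<xi> c \<in> K_pos \<alpha> r1 r2 \<sigma>" using c D by (simp add: admissible_def)
    \<comment> \<open>The modulus to be exhibited is \<open>det (C c)\<close>, positive because the
      Bezout condition excludes \<open>\<xi> c = 0\<close>.\<close>
    obtain w where w: "w \<in> carrier_vec (d - 1)" "gamma_inv d (C c) u * root_mat d (det (C c)) w = C c"
      using exists_factorization[OF u] by blast
    obtain \<mu> where "[poly F \<mu> = 0] (mod det (C c))" "power_reps d (det (C c)) \<mu> w"
      using factorization_imp_root[OF root u w(2,1)] by blast
    then show "\<exists>m \<mu> w. m > 0 \<and> [poly F \<mu> = 0] (mod m) \<and> power_reps d m \<mu> w \<and>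
        gamma_equations d \<sigma> (basis_mat d \<sigma> (\<beta> 1)) (basis_mat d \<sigma> (\<beta> l)) (C c) (\<xi> c) u m w"
      using det_C_pos[OF \<xi> xi_nonzero[OF \<xi> u]] w(2) eqs[OF l u] by blast
  qed

  have backward: "\<exists>!(l, c). ?P l c m \<mu>"
    if m: "m > 0" and J: "Z_basis d (rows_at d \<alpha> (root_mat d m (vec (d - 1) (\<lambda>i. \<mu> ^ (d - 1 - i))))) J"
      "invertible_ideal \<alpha> J" for m \<mu> J
  proof -
    \<comment> \<open>Literal powers serve as reference representatives; any other choice for the
      same \<open>\<mu>\<close> has the same root lattice.\<close>
    define w0 where "w0 = vec (d - 1) (\<lambda>i. \<mu> ^ (d - 1 - i))"
    have w0: "power_reps d m \<mu> w0" by (simp add: power_reps_def w0_def)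
    have J_eq: "J = root_lattice d \<alpha> m w0"
      using Z_basis_range[OF J(1)] root_lattice_eq_range[OF d_pos] by (simp add: w0_def)
    have "?rel `` {J} \<in> narrow_classes \<alpha> r1 r2 \<sigma>"
      unfolding narrow_classes_def using J(2) by (intro quotientI) simp
    then obtain l where l: "l \<in> {1..h}" "?rel `` {J} = ?rel `` {I l}"
      using bij unfolding bij_betw_def by blast
    interpret order_ideal \<alpha> d r1 r2 \<sigma> "I l" "\<beta> l" "\<beta>' l" "b l" by (rule ideal[OF l(1)])
    have "(J, I l) \<in> ?rel"
      using eq_equiv_class[OF l(2) equiv_narrow_rel] I[OF l(1)] by simp
    then obtain x where x: "x \<in> K_pos \<alpha> r1 r2 \<sigma>" "x \<noteq> 0" "J = (\<lambda>t. x * t) ` I l"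
      by (auto simp: narrow_rel_def)
    \<comment> \<open>The narrow class provides only some totally positive \<open>x\<close>. A unit
      moves it into \<open>D\<close> without changing the scaled ideal.\<close>
    then have "\<exists>!y. y \<in> D \<and> (\<exists>e \<in> pos_units \<alpha> r1 r2 \<sigma>. y = e * x)"
      using domain by (simp add: fundamental_domain_def)
    then obtain y e e' where y: "y \<in> D" "y = e * x" and e: "e \<in> Z_adj \<alpha>" "e' \<in> Z_adj \<alpha>" "e * e' = 1"
      by (auto simp: pos_units_def)
    have "y \<noteq> 0" using y e x by auto
    moreover have Jy: "J = (\<lambda>t. y * t) ` I l" using scaled_ideal_unit[OF e] x(3) y(2) by simp
    ultimately obtain c u where c: "c \<in> carrier_vec d" "\<xi> c = y" "bezout_vec d (C c) u"
      "gamma_inv d (C c) u * root_mat d m w0 = C c"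
      using exists_coordinates[OF D[OF y(1)] _ m, of w0] J(1) by (auto simp: w0_def)
    have exists: "?P l c m \<mu>"
      using l(1) c y(1) w0 bezout_imp_Gcd[OF c(3)] eqs[OF l(1) c(3)] by (auto simp: admissible_def)
    have unique: "l1 = l2 \<and> c1 = c2" if P1: "?P l1 c1 m \<mu>" and P2: "?P l2 c2 m \<mu>" for l1 c1 l2 c2
    proof -
      \<comment> \<open>Every solution recovers \<open>J\<close> as a nonzero element of
        \<open>D\<close> times a representative. The narrow class of \<open>J\<close> then fixes the
        index, the fundamental domain fixes the multiplier, and the basis of the inverse ideal fixes
        the coordinates.\<close>
      have scaled: "J = (\<lambda>t. xi d (\<beta>' k) a * t) ` I k \<and> xi d (\<beta>' k) a \<in> D \<and>
          xi d (\<beta>' k) a \<noteq> 0 \<and> a \<in> carrier_vec d" if P: "?P k a m \<mu>" for k a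
      proof -
        have k: "k \<in> {1..h}" and a: "admissible d (\<beta>' k) (b k) D a" using P by auto
        interpret k: order_ideal \<alpha> d r1 r2 \<sigma> "I k" "\<beta> k" "\<beta>' k" "b k" by (rule ideal[OF k])
        obtain v w where v: "bezout_vec d (k.C a) v" "power_reps d m \<mu> w"
          "gamma_inv d (k.C a) v * root_mat d m w = k.C a"
          using P eqs[OF k] by blast
        have "J = (\<lambda>t. k.\<xi> a * t) ` I k"
          using k.scaled_ideal_eq_root_lattice[OF v(1,3)] root_lattice_cong[OF v(2) w0] J_eq by simp
        then show ?thesis using a k.xi_nonzero[OF D v(1)] by (simp add: admissible_def)
      qed
      note s1 = scaled[OF P1] and s2 = scaled[OF P2]
      let ?x1 = "xi d (\<beta>' l1) c1" and ?x2 = "xi d (\<beta>' l2) c2"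
      have in_class: "(J, I k) \<in> ?rel" if "k \<in> {1..h}" "J = (\<lambda>t. z * t) ` I k" "z \<in> D" "z \<noteq> 0" for k z
        using that J(2) I[OF that(1)] D[OF that(3)] by (auto simp: narrow_rel_def)
      have "?rel `` {I l1} = ?rel `` {I l2}"
        using in_class[of l1 ?x1] in_class[of l2 ?x2] s1 s2 P1 P2 equiv_class_eq[OF equiv_narrow_rel] by metis
      then have l12: "l1 = l2" using bij P1 P2 by (auto simp: bij_betw_def dest: inj_onD)
      interpret l1: order_ideal \<alpha> d r1 r2 \<sigma> "I l1" "\<beta> l1" "\<beta>' l1" "b l1" using P1 by (intro ideal) simp
      have "?x1 = ?x2" using l1.scaled_ideal_inj[OF domain, of ?x1 ?x2] s1 s2 l12 by metis
      then show ?thesis using l12 s1 s2 l1.xi_inj by metis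
    qed
    show ?thesis
      by (rule ex1_pairI[where P = "\<lambda>l c. ?P l c m \<mu>", OF exists]) (rule unique[OF _ exists])
  qed

  have reps_bij: "(\<forall>u. bezout_vec d (C_mat d (b l) c) u \<longrightarrow>
        (\<exists>!w. power_reps d m \<mu> w \<and>
          gamma_equations d \<sigma> (basis_mat d \<sigma> (\<beta> 1)) (basis_mat d \<sigma> (\<beta> l))
            (C_mat d (b l) c) (xi d (\<beta>' l) c) u m w)) \<and>
      (\<forall>w. power_reps d m \<mu> w \<longrightarrow>
        (\<exists>!u. bezout_vec d (C_mat d (b l) c) u \<and>
          gamma_equations d \<sigma> (basis_mat d \<sigma> (\<beta> 1)) (basis_mat d \<sigma> (\<beta> l))
            (C_mat d (b l) c) (xi d (\<beta>' l) c) u m w))"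
    if m: "m > 0" and P: "?P l c m \<mu>" for l c m \<mu>
  proof (intro conjI allI impI)
    have l: "l \<in> {1..h}" using P by simp
    interpret order_ideal \<alpha> d r1 r2 \<sigma> "I l" "\<beta> l" "\<beta>' l" "b l" by (rule ideal[OF l])
    obtain u0 w0 where u0: "bezout_vec d (C c) u0" "gamma_inv d (C c) u0 * root_mat d m w0 = C c"
      "power_reps d m \<mu> w0" using P eqs[OF l] by blast
    show "\<exists>!w. power_reps d m \<mu> w \<and>
        gamma_equations d \<sigma> (basis_mat d \<sigma> (\<beta> 1)) (basis_mat d \<sigma> (\<beta> l)) (C c) (\<xi> c) u m w"
      if u: "bezout_vec d (C c) u" for u
      unfolding eqs[OF l u] by (rule reps_of_bezout[OF u0 u])
    show "\<exists>!u. bezout_vec d (C c) u \<and>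
        gamma_equations d \<sigma> (basis_mat d \<sigma> (\<beta> 1)) (basis_mat d \<sigma> (\<beta> l)) (C c) (\<xi> c) u m w"
      if w: "power_reps d m \<mu> w" for w
      using bezout_of_reps[OF m u0 w] eqs[OF l] by (simp cong: conj_cong)
  qed

  show ?thesis
  proof (rule conjI, goal_cases)
    case 1
    show ?case by (intro ballI allI impI) (rule forward)
  next
    case 2
    show ?case
    proof (intro allI impI, elim conjE, rule conjI, goal_cases)
      case (1 m \<mu> J)
      then show ?case by (intro backward)
    next
      case (2 m \<mu> J)
      then show ?case
        by (intro ballI allI impI) (rule reps_bij, assumption, rule conjI, assumption, assumption)
    qed
  qed
qed

end
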